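(* There exists a real $\varepsilon_0>0$ such that the following holds for every fixed real $0<\varepsilon\le\varepsilon_0$. Let $G=G(k)$ be a graph on $n$ vertices with minimum degree at least $(1-\varepsilon)k$, where $n\le(1+\varepsilon)k$. For $p=p(k)\ge\frac{(1+4\varepsilon)\log k}{k}$, the random subgraph $G_p$ is asymptotically almost surely Hamiltonian.
   Context: For a graph $G$ and $p\in[0,1]$, $G_p$ denotes the random subgraph of $G$ on the same vertex set obtained by keeping each edge of $G$ independently with probability $p$. All objects are sequences indexed by $k\to\infty$, and "asymptotically almost surely" means with probability tending to $1$ as $k\to\infty$. $\log$ is the natural logarithm. Hamiltonian means containing a cycle through all vertices. *)

theory Defs
  imports "HOL-Probability.Probability"
begin

datatype 'a graph = Graph (verts: "'a set") (edges: "'a set set")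

text \<open>Finite simple graphs with at least one vertex. Edges are two-element sets of vertices.\<close>

definition finite_simple_graph :: "'a graph \<Rightarrow> bool" where
  "finite_simple_graph G \<longleftrightarrow>
     finite (verts G) \<and> verts G \<noteq> {} \<and> (\<forall>e\<in>edges G. e \<subseteq> verts G \<and> card e = 2)"

definition degree :: "'a graph \<Rightarrow> 'a \<Rightarrow> nat" where
  "degree G v = card {e \<in> edges G. v \<in> e}"

definition min_degree :: "'a graph \<Rightarrow> nat" where
  "min_degree G = Min (degree G ` verts G)"

text \<open>A cycle is listed without repeating its first vertex at the end; the index
  wraps around modulo the length.\<close>

definition is_cycle :: "'a graph \<Rightarrow> 'a list \<Rightarrow> bool" where
  "is_cycle G vs \<longleftrightarrow>
     length vs \<ge> 3 \<and> distinct vs \<and> set vs \<subseteq> verts G \<and>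
     (\<forall>i<length vs. {vs ! i, vs ! (Suc i mod length vs)} \<in> edges G)"

definition hamiltonian :: "'a graph \<Rightarrow> bool" where
  "hamiltonian G \<longleftrightarrow> (\<exists>vs. is_cycle G vs \<and> set vs = verts G)"

text \<open>The distribution of $G_p$: independent Bernoulli variables, indexed by the edges of $G$,
  decide which edges are kept. Meaningful for a finite edge set and $0 \le p \le 1$.\<close>

definition random_subgraph :: "'a graph \<Rightarrow> real \<Rightarrow> 'a graph pmf" where
  "random_subgraph G p =
     map_pmf (\<lambda>keep. Graph (verts G) {e \<in> edges G. keep e})
       (Pi_pmf (edges G) False (\<lambda>_. bernoulli_pmf p))"

end

theory Submission
  imports Defs "HOL-Real_Asymp.Real_Asymp"
begin

text \<open>
  We have $1 - p \le (1 - p_1)(1 - q)^{2n}$ with $p_1 = (1 + \frac72\varepsilon)\log k/k$ and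
  $q$ of order $\varepsilon \log k/k^2$, so that $G_p$ dominates the union of $G_{p_1}$ and $2n$
  independent sparse rounds. The slack $\frac72\varepsilon$ makes a single union bound, over a set
  $S$, its neighbourhood $T$ and a choice of an edge into $S$ from each vertex of $T$, strong enough
  to show that a.a.s.\ every set of at most $k/10$ vertices of $G_{p_1}$ expands by a factor of two
  and that $G_{p_1}$ is connected. By Posa's rotations, every non-Hamiltonian graph containing
  $G_{p_1}$ then has at least $3k^2/1000$ boosters among the edges of $G$, since each vertex has at
  most $2\varepsilon k \le k/25$ non-neighbours in $G$. Hence each sparse round misses all boosters
  with probability at most $\delta = k^{-\varepsilon/2000}$, and at most $n$ successful rounds are
  needed. The probability that fewer than $n$ of the $2n$ rounds succeed is at most
  $\delta^{-n}(2\delta)^{2n} \le 4\delta \to 0$.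
\<close>

section \<open>Rotations of longest paths\<close>

definition edge_path :: "'a set \<Rightarrow> 'a set set \<Rightarrow> 'a list \<Rightarrow> bool" where
  "edge_path V E xs \<longleftrightarrow> distinct xs \<and> set xs \<subseteq> V \<and> successively (\<lambda>a b. {a, b} \<in> E) xs"

definition nbh :: "'a set set \<Rightarrow> 'a set \<Rightarrow> 'a set" where
  "nbh E S = {u. u \<notin> S \<and> (\<exists>v\<in>S. {v, u} \<in> E)}"

text \<open>Posa's rotation with the first vertex fixed: the path edge from \<open>u\<close> to
  \<open>hd bs\<close> is exchanged for the edge from \<open>u\<close> to the last vertex, so
  \<open>hd bs\<close> becomes the new end.\<close>

inductive rotation :: "'a set set \<Rightarrow> 'a list \<Rightarrow> 'a list \<Rightarrow> bool" for E xs where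
  refl: "rotation E xs xs"
| step: "rotation E xs (as @ u # bs) \<Longrightarrow> bs \<noteq> [] \<Longrightarrow> {u, last bs} \<in> E \<Longrightarrow>
    rotation E xs (as @ u # rev bs)"

definition consec :: "'a list \<Rightarrow> 'a \<Rightarrow> 'a \<Rightarrow> bool" where
  "consec xs a b \<longleftrightarrow> (\<exists>ys zs. xs = ys @ a # b # zs \<or> xs = ys @ b # a # zs)"

lemma successively_edge_rev:
  "successively (\<lambda>a b. {a, b} \<in> E) (rev xs) \<longleftrightarrow> successively (\<lambda>a b. {a, b} \<in> E) xs"
  by (simp add: successively_rev insert_commute)

lemma edge_path_rev: "edge_path V E (rev xs) \<longleftrightarrow> edge_path V E xs"
  by (simp add: edge_path_def successively_edge_rev del: successively_rev)

lemma rotation_edge_path: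
  assumes "rotation E xs ys" "edge_path V E xs"
  shows "edge_path V E ys \<and> set ys = set xs \<and> length ys = length xs \<and> (xs \<noteq> [] \<longrightarrow> hd ys = hd xs)"
  using assms
proof (induction)
  case refl
  then show ?case by simp
next
  case (step as u bs)
  then have IH: "edge_path V E (as @ u # bs)" "set (as @ u # bs) = set xs"
    "length (as @ u # bs) = length xs" "xs \<noteq> [] \<Longrightarrow> hd (as @ u # bs) = hd xs"
    by auto
  have "edge_path V E (as @ u # rev bs)"
    using IH(1) step.hyps
    by (auto simp: edge_path_def successively_append_iff successively_Cons successively_edge_rev hd_rev
        simp del: successively_rev)
  moreover have "xs \<noteq> [] \<Longrightarrow> hd (as @ u # rev bs) = hd xs"
    using IH(4) by (cases as) auto
  ultimately show ?case
    using IH by auto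
qed

section \<open>Adjacency along a path and its behaviour under rotation\<close>

lemma consec_append1: "consec xs a b \<Longrightarrow> consec (ws @ xs) a b"
  unfolding consec_def by (metis append.assoc)

lemma consec_append2: "consec xs a b \<Longrightarrow> consec (xs @ ws) a b"
  unfolding consec_def by (metis append.assoc append_Cons)

lemma consec_rev: "consec xs a b \<Longrightarrow> consec (rev xs) a b"
  unfolding consec_def
proof (elim exE disjE)
  fix ys zs assume "xs = ys @ a # b # zs"
  then have "rev xs = rev zs @ b # a # rev ys" by simp
  then show "\<exists>ys zs. rev xs = ys @ a # b # zs \<or> rev xs = ys @ b # a # zs" by blast
next
  fix ys zs assume "xs = ys @ b # a # zs"
  then have "rev xs = rev zs @ a # b # rev ys" by simp
  then show "\<exists>ys zs. rev xs = ys @ a # b # zs \<or> rev xs = ys @ b # a # zs" by blast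
qed

lemma consec_commute: "consec xs a b \<longleftrightarrow> consec xs b a"
  unfolding consec_def by blast

lemma append_eq_split:
  assumes "xs @ zs = ys @ a # b # ws" "xs \<noteq> []" "zs \<noteq> []"
  shows "consec xs a b \<or> consec zs a b \<or> (last xs = a \<and> hd zs = b)"
proof -
  from assms(1) consider us where "xs = ys @ us" "us @ zs = a # b # ws"
    | us where "ys = xs @ us" "zs = us @ a # b # ws"
    unfolding append_eq_append_conv2 by (metis append_Nil2)
  then show ?thesis
  proof cases
    case 1
    consider "us = []" | "us = [a]" | vs where "us = a # b # vs"
      using 1(2) by (cases us; cases "tl us") auto
    then show ?thesis
    proof cases
      case 1
      then have "zs = [] @ a # b # ws" using \<open>us @ zs = _\<close> by simp
      then show ?thesis unfolding consec_def by blast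
    next
      case 2
      then show ?thesis using \<open>us @ zs = _\<close> \<open>xs = _\<close> by auto
    next
      case (3 vs)
      then show ?thesis using \<open>xs = ys @ us\<close> by (auto simp: consec_def)
    qed
  next
    case 2
    then show ?thesis by (auto simp: consec_def)
  qed
qed

text \<open>Adjacency on a path ignores direction, so reversing the tail keeps every adjacency
  inside the two pieces; only the one at the seam can be lost.\<close>

lemma consec_rotate:
  assumes "consec (as @ u # bs) a b" "bs \<noteq> []"
  shows "consec (as @ u # rev bs) a b \<or> {a, b} = {u, hd bs}"
proof -
  obtain c d ys zs where cd: "as @ u # bs = ys @ c # d # zs" "{c, d} = {a, b}"
    and sym: "\<And>xs. consec xs c d \<longleftrightarrow> consec xs a b"
  proof -
    from assms(1) consider ys zs where "as @ u # bs = ys @ a # b # zs"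
      | ys zs where "as @ u # bs = ys @ b # a # zs"
      unfolding consec_def by blast
    then show ?thesis
      by cases (use that in \<open>auto simp: insert_commute consec_commute\<close>)
  qed
  have "consec (as @ [u]) c d \<or> consec bs c d \<or> (last (as @ [u]) = c \<and> hd bs = d)"
    by (rule append_eq_split[of _ _ ys _ _ zs]) (use cd assms in auto)
  then consider "consec (as @ [u]) c d" | "consec bs c d" | "u = c" "hd bs = d"
    by auto
  then show ?thesis
  proof cases
    case 1
    then have "consec ((as @ [u]) @ rev bs) c d" by (rule consec_append2)
    then show ?thesis using sym by simp
  next
    case 2
    then have "consec ((as @ [u]) @ rev bs) c d" by (intro consec_append1 consec_rev)
    then show ?thesis using sym by simp
  next
    case 3
    then show ?thesis using cd by auto
  qed
qed

text \<open>Any path neighbour of \<open>u\<close> is its successor \<open>w\<close> or its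
  predecessor \<open>last as\<close>, and two distinct neighbours cannot both be the
  predecessor.\<close>

lemma consec_unique:
  assumes "distinct xs" "xs = as @ u # w # bs" "consec xs u a" "consec xs u b" "a \<noteq> b"
  shows "w = a \<or> w = b"
proof -
  have u: "u \<notin> set as" "u \<notin> set (w # bs)" using assms(1,2) by auto
  have *: "w = c \<or> (as \<noteq> [] \<and> last as = c)" if "consec xs u c" for c
  proof -
    from that obtain ys zs where "xs = ys @ u # c # zs \<or> xs = ys @ c # u # zs"
      unfolding consec_def by blast
    then show ?thesis
    proof
      assume "xs = ys @ u # c # zs"
      then have "as = ys \<and> w # bs = c # zs"
        using assms(2) append_Cons_eq_iff[OF u, of ys "c # zs"] by auto
      then show ?thesis by auto
    next
      assume "xs = ys @ c # u # zs"
      then have "as = ys @ [c]"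
        using assms(2) append_Cons_eq_iff[OF u, of "ys @ [c]" zs] by auto
      then show ?thesis by auto
    qed
  qed
  show ?thesis using *[OF assms(3)] *[OF assms(4)] assms(5) by auto
qed

definition longest_path :: "'a set \<Rightarrow> 'a set set \<Rightarrow> 'a list \<Rightarrow> bool" where
  "longest_path V E xs \<longleftrightarrow> edge_path V E xs \<and> (\<forall>ys. edge_path V E ys \<longrightarrow> length ys \<le> length xs)"

text \<open>Every outside neighbour of an end in \<open>X\<close> turns out to be adjacent along the
  original path \<open>xs\<close> to some vertex of \<open>X\<close>, and each vertex has at most
  two neighbours on \<open>xs\<close>.\<close>

lemma posa:
  assumes longest: "longest_path V E xs" and "finite V" "xs \<noteq> []" and E: "\<And>e. e \<in> E \<Longrightarrow> e \<subseteq> V"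
  defines "X \<equiv> last ` {ys. rotation E xs ys}"
  shows "card (nbh E X) \<le> 2 * card X"
proof -
  have path: "edge_path V E xs" using longest by (simp add: longest_path_def)
  have dist: "distinct xs" using path by (simp add: edge_path_def)
  have rot: "edge_path V E ys" "set ys = set xs" "length ys = length xs" "hd ys = hd xs" "ys \<noteq> []"
    if "rotation E xs ys" for ys
    using rotation_edge_path[OF that path] \<open>xs \<noteq> []\<close> by auto
  have X: "X \<subseteq> set xs"
    using rot by (fastforce simp: X_def)
  then have finX: "finite X" by (rule finite_subset) simp
  \<comment> \<open>A rotation only destroys path edges at a vertex that becomes an endpoint, so edges of \<^term>\<open>xs\<close>
     avoiding \<^term>\<open>X\<close> survive all rotations.\<close>
  have keep: "consec ys a b" if "rotation E xs ys" "consec xs a b" "a \<notin> X" "b \<notin> X" for ys a b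
    using that(1)
  proof induction
    case refl
    show ?case by fact
  next
    case (step as u bs)
    then have "rotation E xs (as @ u # rev bs)" by (blast intro: rotation.step)
    then have "last (as @ u # rev bs) \<in> X" unfolding X_def by blast
    then have "hd bs \<in> X" using step.hyps by (simp add: last_rev)
    then show ?case
      using consec_rotate[OF step.IH step.hyps(2)] that by (auto simp: doubleton_eq_iff)
  qed
  \<comment> \<open>If no neighbour of \<open>u\<close> on \<open>xs\<close> lay in
    \<open>X\<close>, these neighbours would all remain next to \<open>u\<close> on
    \<open>ys\<close>. Rotating \<open>ys\<close> at \<open>u\<close> turns the successor
    \<open>w\<close> of \<open>u\<close> into an end, so \<open>w\<close> lies in \<open>X\<close>;
    yet \<open>w\<close> has to be one of the surviving neighbours.\<close>
  have main: "\<exists>x\<in>X. consec xs x u" if "u \<in> nbh E X" for u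
  proof (rule ccontr)
    assume no: "\<not> (\<exists>x\<in>X. consec xs x u)"
    from that obtain ys where ys: "rotation E xs ys" "{last ys, u} \<in> E" and u: "u \<notin> X"
      by (auto simp: nbh_def X_def)
    note R = rot[OF ys(1)]
    have "u \<in> set ys"
    proof (rule ccontr)
      assume "u \<notin> set ys"
      then have "edge_path V E (ys @ [u])"
        using R ys(2) E[OF ys(2)] by (auto simp: edge_path_def successively_append_iff)
      then show False using longest R by (fastforce simp: longest_path_def)
    qed
    then obtain as bs where split: "ys = as @ u # bs" by (meson split_list)
    have "bs \<noteq> []" using u ys(1) split unfolding X_def by force
    then obtain w cs where bs: "bs = w # cs" by (cases bs) auto
    have "rotation E xs (as @ u # rev bs)"
      using ys split \<open>bs \<noteq> []\<close> by (auto intro!: rotation.step simp: insert_commute)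
    then have "last (as @ u # rev bs) \<in> X" unfolding X_def by blast
    then have w: "w \<in> X" using bs by simp
    have "u \<in> set xs" using R(2) \<open>u \<in> set ys\<close> by simp
    then obtain ps qs where xs: "xs = ps @ u # qs" by (meson split_list)
    have nX: "c \<notin> X" if "consec xs u c" for c
      using no that consec_commute by fast
    have "distinct ys" using R by (simp add: edge_path_def)
    have next_ne: "w \<noteq> c" if "consec xs u c" for c
      using nX[OF that] w by blast
    have qs: "qs \<noteq> []"
      using u rotation.refl[of E xs] xs by (auto simp: X_def image_iff)
    then have cq: "consec xs u (hd qs)"
      unfolding consec_def xs by (metis list.exhaust_sel)
    have cqy: "consec ys u (hd qs)" using keep[OF ys(1) cq u nX[OF cq]] .
    \<comment> \<open>A first vertex of \<open>xs\<close> stays first under rotations and has a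
      single path neighbour, which must then be \<open>w\<close>. Any other \<open>u\<close> has two
      distinct surviving neighbours, and \<open>consec_unique\<close> identifies \<open>w\<close>
      with one of them.\<close>
    show False
    proof (cases "ps = []")
      case True
      then have "hd ys = u" using R xs by simp
      then have "as = []" using split \<open>distinct ys\<close> by (cases as) auto
      obtain vs zs where "ys = vs @ u # hd qs # zs \<or> ys = vs @ hd qs # u # zs"
        using cqy unfolding consec_def by blast
      moreover have "u \<notin> set bs" using split \<open>distinct ys\<close> by auto
      ultimately have "hd qs = hd bs"
        using split \<open>as = []\<close> by (cases vs) auto
      then have "hd qs = w" using bs by simp
      then show False using next_ne[OF cq] by simp
    next
      case False
      then have "xs = butlast ps @ last ps # u # qs" using xs by simp
      then have cp: "consec xs u (last ps)"
        unfolding consec_def by metis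
      have "consec ys u (last ps)" using keep[OF ys(1) cp u nX[OF cp]] .
      moreover have "last ps \<noteq> hd qs"
        using dist xs last_in_set[OF False] hd_in_set[OF qs] by auto
      ultimately show False
        using consec_unique[OF \<open>distinct ys\<close> _ cqy] split bs next_ne cp cq by metis
    qed
  qed
  \<comment> \<open>Choice functions for the two path neighbours. At the ends of the path one value
    is arbitrary, which can only enlarge the covering set \<open>succ\<close> X \<union> pred
    \<open>X\<close>.\<close>
  define succ pred where "succ x = (SOME u. \<exists>ps qs. xs = ps @ x # u # qs)"
    and "pred x = (SOME u. \<exists>ps qs. xs = ps @ u # x # qs)" for x
  have "u = succ x \<or> u = pred x" if c: "consec xs x u" for x u
  proof -
    from c obtain ps qs where "xs = ps @ x # u # qs \<or> xs = ps @ u # x # qs"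
      unfolding consec_def by blast
    then show ?thesis
    proof
      assume 1: "xs = ps @ x # u # qs"
      have "\<exists>ps qs. xs = ps @ x # succ x # qs"
        unfolding succ_def by (rule someI_ex) (use 1 in blast)
      then obtain ps' qs' where "xs = ps' @ x # succ x # qs'" by blast
      moreover have "x \<notin> set ps" "x \<notin> set (u # qs)" using 1 dist by auto
      ultimately show ?thesis
        using 1 append_Cons_eq_iff[of x ps "u # qs" ps' "succ x # qs'"] by simp
    next
      assume 1: "xs = ps @ u # x # qs"
      have "\<exists>ps qs. xs = ps @ pred x # x # qs"
        unfolding pred_def by (rule someI_ex) (use 1 in blast)
      then obtain ps' qs' where "xs = ps' @ pred x # x # qs'" by blast
      moreover have "x \<notin> set (ps @ [u])" "x \<notin> set qs" using 1 dist by auto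
      ultimately show ?thesis
        using 1 append_Cons_eq_iff[of x "ps @ [u]" qs "ps' @ [pred x]" qs'] by simp
    qed
  qed
  then have "nbh E X \<subseteq> succ ` X \<union> pred ` X"
    using main by blast
  then have "card (nbh E X) \<le> card (succ ` X \<union> pred ` X)"
    using finX by (intro card_mono) auto
  also have "\<dots> \<le> card (succ ` X) + card (pred ` X)" by (rule card_Un_le)
  also have "\<dots> \<le> card X + card X" using finX by (intro add_mono card_image_le)
  finally show ?thesis by simp
qed

section \<open>Longest paths: invariance, existence and length\<close>

lemma rotation_longest_path:
  assumes "rotation E xs ys" "longest_path V E xs"
  shows "longest_path V E ys"
  using rotation_edge_path[OF assms(1), of V] assms(2) by (auto simp: longest_path_def)

lemma longest_path_rev: "longest_path V E (rev xs) \<longleftrightarrow> longest_path V E xs"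
  by (simp add: longest_path_def edge_path_rev)

lemma length_edge_path:
  assumes "edge_path V E xs" "finite V"
  shows "length xs \<le> card V"
  using assms by (metis card_mono distinct_card edge_path_def)

lemma edge_path_mono: "edge_path V E xs \<Longrightarrow> E \<subseteq> E' \<Longrightarrow> edge_path V E' xs"
  unfolding edge_path_def by (auto elim: successively_mono)

lemma finite_lengths: "finite V \<Longrightarrow> finite (length ` {xs. edge_path V E xs})"
  by (rule finite_subset[of _ "{..card V}"]) (auto dest: length_edge_path)

lemma edge_path_Nil: "edge_path V E []"
  by (simp add: edge_path_def)

lemma ex_longest_path:
  assumes "finite V"
  obtains xs where "longest_path V E xs"
proof -
  have "Max (length ` {xs. edge_path V E xs}) \<in> length ` {xs. edge_path V E xs}"
    using finite_lengths[OF assms] edge_path_Nil by (intro Max_in) auto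
  then obtain xs where "edge_path V E xs" "length xs = Max (length ` {xs. edge_path V E xs})"
    by auto
  then have "longest_path V E xs"
    using finite_lengths[OF assms] by (auto simp: longest_path_def)
  then show ?thesis by (rule that)
qed

lemma longest_path_nonempty:
  assumes "longest_path V E xs" "V \<noteq> {}"
  shows "xs \<noteq> []"
proof -
  obtain v where "v \<in> V" using assms(2) by blast
  then have "edge_path V E [v]" by (simp add: edge_path_def)
  then show ?thesis using assms(1) by (fastforce simp: longest_path_def)
qed

section \<open>Boosters\<close>

text \<open>Each booster added lowers this quantity, and it vanishes exactly on Hamiltonian graphs.\<close>

definition deficit :: "'a set \<Rightarrow> 'a set set \<Rightarrow> nat" where
  "deficit V E = (if hamiltonian (Graph V E) then 0
     else Suc (card V) - Max (length ` {xs. edge_path V E xs}))"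

lemma hamiltonian_mono:
  "hamiltonian (Graph V E) \<Longrightarrow> E \<subseteq> E' \<Longrightarrow> hamiltonian (Graph V E')"
  unfolding hamiltonian_def is_cycle_def by auto

lemma deficit_longest:
  assumes "finite V" "longest_path V E xs" "\<not> hamiltonian (Graph V E)"
  shows "deficit V E = Suc (card V) - length xs"
proof -
  have "Max (length ` {xs. edge_path V E xs}) = length xs"
    using assms finite_lengths[OF assms(1)] by (intro Max_eqI) (auto simp: longest_path_def)
  then show ?thesis using assms(3) by (simp add: deficit_def)
qed

lemma deficit_le_edge_path:
  assumes "finite V" "edge_path V E xs"
  shows "deficit V E \<le> Suc (card V) - length xs"
proof -
  have "length xs \<le> Max (length ` {xs. edge_path V E xs})"
    using assms finite_lengths[OF assms(1)] by (intro Max_ge) auto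
  then show ?thesis unfolding deficit_def by (auto intro: diff_le_mono2)
qed

lemma deficit_mono:
  assumes "finite V" "E \<subseteq> E'"
  shows "deficit V E' \<le> deficit V E"
proof (cases "hamiltonian (Graph V E)")
  case True
  then show ?thesis using hamiltonian_mono assms by (fastforce simp: deficit_def)
next
  case False
  obtain xs where "longest_path V E xs" using ex_longest_path[OF assms(1)] .
  then show ?thesis
    using deficit_longest[OF assms(1) _ False] deficit_le_edge_path[OF assms(1)]
      edge_path_mono[OF _ assms(2)] by (metis longest_path_def)
qed

text \<open>Thanks to the \<open>Suc\<close>, a non-Hamiltonian graph with a spanning path still has
  deficit 1; the last unit is spent on closing the cycle.\<close>

lemma deficit_eq_0:
  assumes "finite V"
  shows "deficit V E = 0 \<longleftrightarrow> hamiltonian (Graph V E)"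
proof (cases "hamiltonian (Graph V E)")
  case False
  obtain xs where "longest_path V E xs" using ex_longest_path[OF assms(1)] .
  then show ?thesis
    using deficit_longest[OF assms(1) _ False] length_edge_path[OF _ assms] False
    by (fastforce simp: longest_path_def)
qed (simp add: deficit_def)

lemma deficit_le_card:
  assumes "finite V" "V \<noteq> {}"
  shows "deficit V E \<le> card V"
proof -
  obtain v where "v \<in> V" using assms(2) by blast
  then have "edge_path V E [v]" by (simp add: edge_path_def)
  from deficit_le_edge_path[OF assms(1) this] show ?thesis by simp
qed

lemma hamiltonian_close_path:
  assumes "edge_path V E xs" "length xs \<ge> 3" "set xs = V" "{last xs, hd xs} \<in> E"
  shows "hamiltonian (Graph V E)"
proof -
  have "{xs ! i, xs ! (Suc i mod length xs)} \<in> E" if "i < length xs" for i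
  proof (cases "Suc i < length xs")
    case True
    then show ?thesis
      using assms(1) successively_nth[of _ xs i] by (auto simp: edge_path_def)
  next
    case False
    then have "i = length xs - 1" "Suc i = length xs" using that by auto
    then show ?thesis
      using assms(2,4) by (cases "xs = []") (auto simp: last_conv_nth hd_conv_nth)
  qed
  then show ?thesis
    using assms unfolding hamiltonian_def is_cycle_def edge_path_def by (intro exI[of _ xs]) auto
qed

text \<open>Joining the ends of a longest path produces a cycle. If it spans, the graph has become
  Hamiltonian; otherwise connectivity gives an edge leaving the cycle, and opening the cycle there
  yields a path with one more vertex.\<close>

lemma deficit_close_path:
  assumes "finite V" and "\<And>e. e \<in> E \<Longrightarrow> e \<subseteq> V"
    and connected: "\<And>S. S \<subseteq> V \<Longrightarrow> S \<noteq> {} \<Longrightarrow> S \<noteq> V \<Longrightarrow> nbh E S \<noteq> {}"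
    and "\<not> hamiltonian (Graph V E)" and xs: "longest_path V E xs" "length xs \<ge> 3"
  shows "deficit V (insert {last xs, hd xs} E) < deficit V E"
proof -
  define E' where "E' = insert {last xs, hd xs} E"
  have E': "{last xs, hd xs} \<in> E'" "E \<subseteq> E'" by (auto simp: E'_def)
  have p: "edge_path V E xs" using xs by (simp add: longest_path_def)
  then have p': "edge_path V E' xs" using E'(2) by (rule edge_path_mono)
  have d: "deficit V E = Suc (card V) - length xs" "length xs \<le> card V"
    using deficit_longest length_edge_path p assms by auto
  have "deficit V E' < deficit V E"
  proof (cases "set xs = V")
    case True
    then have "hamiltonian (Graph V E')"
      using p' xs True E'(1) by (intro hamiltonian_close_path) auto
    then show ?thesis using d by (simp add: deficit_def)
  next
    case False
    have "set xs \<subseteq> V" "xs \<noteq> []" using p xs by (auto simp: edge_path_def)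
    then have "nbh E (set xs) \<noteq> {}" using connected False by auto
    then obtain u v where uv: "u \<notin> set xs" "v \<in> set xs" "{v, u} \<in> E"
      by (auto simp: nbh_def)
    then obtain as bs where split: "xs = as @ v # bs" by (meson split_list)
    have "u \<in> V" using uv assms(2) by blast
    \<comment> \<open>The cycle is traversed from the successor of \<open>v\<close>, across the
      added edge, round to \<open>v\<close>, and then left towards \<open>u\<close>.\<close>
    have "edge_path V E' ((bs @ as) @ [v, u])"
      using p' split uv \<open>u \<in> V\<close> E'
      by (cases as; cases "bs = []") (auto simp: edge_path_def successively_append_iff successively_Cons hd_append)
    from deficit_le_edge_path[OF assms(1) this] split d show ?thesis by simp
  qed
  then show ?thesis by (simp add: E'_def)
qed

text \<open>The strict factor two is what contradicts the bound in \<open>posa\<close>; the second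
  clause is connectivity. Both clauses survive the addition of edges, as the sprinkling argument
  demands.\<close>

definition expander :: "'a set \<Rightarrow> 'a set set \<Rightarrow> nat \<Rightarrow> bool" where
  "expander V E m \<longleftrightarrow>
     (\<forall>S\<subseteq>V. S \<noteq> {} \<longrightarrow> card S \<le> m \<longrightarrow> 2 * card S < card (nbh E S)) \<and>
     (\<forall>S\<subseteq>V. S \<noteq> {} \<longrightarrow> S \<noteq> V \<longrightarrow> nbh E S \<noteq> {})"

lemma nbh_mono: "E \<subseteq> E' \<Longrightarrow> nbh E S \<subseteq> nbh E' S"
  by (auto simp: nbh_def)

lemma nbh_subset: "(\<And>e. e \<in> E \<Longrightarrow> e \<subseteq> V) \<Longrightarrow> nbh E S \<subseteq> V"
  by (fastforce simp: nbh_def)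

lemma expander_mono:
  assumes "expander V E m" "E \<subseteq> E'" "finite V" "\<And>e. e \<in> E' \<Longrightarrow> e \<subseteq> V"
  shows "expander V E' m"
proof -
  have "card (nbh E S) \<le> card (nbh E' S)" for S
    using nbh_mono[OF assms(2)] nbh_subset[OF assms(4)] assms(3) by (meson card_mono finite_subset)
  moreover have "nbh E S \<noteq> {} \<Longrightarrow> nbh E' S \<noteq> {}" for S
    using nbh_mono[OF assms(2), of S] by blast
  ultimately show ?thesis
    using assms(1) unfolding expander_def by (meson order_less_le_trans)
qed

text \<open>By \<open>posa\<close> the set of ends has too few neighbours to obey the expansion
  clause, so it must be larger than \<open>m\<close>.\<close>

lemma card_rotation_ends:
  assumes "longest_path V E xs" "finite V" "V \<noteq> {}" "\<And>e. e \<in> E \<Longrightarrow> e \<subseteq> V" "expander V E m"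
  shows "m < card (last ` {ys. rotation E xs ys})" "last ` {ys. rotation E xs ys} \<subseteq> set xs"
proof -
  let ?X = "last ` {ys. rotation E xs ys}"
  have ne: "xs \<noteq> []" using longest_path_nonempty assms by blast
  have "\<And>ys. rotation E xs ys \<Longrightarrow> set ys = set xs \<and> ys \<noteq> []"
    using rotation_edge_path assms(1) ne by (fastforce simp: longest_path_def)
  then show sub: "?X \<subseteq> set xs" by fastforce
  have "?X \<noteq> {}" using rotation.refl by fast
  moreover have "set xs \<subseteq> V" using assms(1) by (simp add: longest_path_def edge_path_def)
  ultimately show "m < card ?X"
    using posa[OF assms(1,2) ne assms(4)] assms(5) sub unfolding expander_def
    by (meson leD leI order_trans)
qed

text \<open>Accounts for the factor 2 in \<open>card_boosters\<close>, where boosters are counted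
  through ordered pairs of ends.\<close>

lemma doubleton_pairs:
  "finite {(x, y). {x, y} = e}" "card {(x, y). {x, y} = e} \<le> 2"
proof -
  have "finite {(x, y). {x, y} = e} \<and> card {(x, y). {x, y} = e} \<le> 2"
  proof (cases "\<exists>a b. e = {a, b}")
    case True
    then obtain a b where "e = {a, b}" by blast
    then have "{(x, y). {x, y} = e} \<subseteq> set [(a, b), (b, a)]"
      by (auto simp: doubleton_eq_iff)
    then have "finite {(x, y). {x, y} = e}" "card {(x, y). {x, y} = e} \<le> card (set [(a, b), (b, a)])"
      using finite_subset card_mono by blast+
    then show ?thesis using card_length[of "[(a, b), (b, a)]"] by simp
  next
    case False
    then have "{(x, y). {x, y} = e} = {}" by auto
    then show ?thesis by simp
  qed
  then show "finite {(x, y). {x, y} = e}" "card {(x, y). {x, y} = e} \<le> 2" by blast+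
qed

text \<open>Double counting over pairs of ends of longest paths. Rotations give more than
  \<open>m\<close> ends \<open>x\<close>; reversing a path that ends in \<open>x\<close> and
  rotating again with \<open>x\<close> fixed gives more than \<open>m\<close> partners
  \<open>y\<close>. Joining \<open>x\<close> to \<open>y\<close> is a booster whenever that pair is
  an edge of \<open>G\<close>, and at most \<open>r\<close> partners fail this.\<close>

lemma card_boosters:
  assumes "finite V" "V \<noteq> {}" "\<And>e. e \<in> E \<Longrightarrow> e \<subseteq> V" "expander V E m" "m \<ge> 2"
    and nonham: "\<not> hamiltonian (Graph V E)"
    and G: "finite G" "\<And>e. e \<in> G \<Longrightarrow> e \<subseteq> V" "\<And>v. v \<in> V \<Longrightarrow> card (V - {u. {v, u} \<in> G}) \<le> r"
  shows "(m + 1) * (m + 1 - r) \<le> 2 * card {e\<in>G. deficit V (insert e E) < deficit V E}"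
proof -
  let ?B = "{e\<in>G. deficit V (insert e E) < deficit V E}"
  \<comment> \<open>More than \<open>m\<close> possible ends lie on the path, so
    \<open>m \<ge> 2\<close> forces at least three vertices and closing the path gives a genuine
    cycle.\<close>
  have boost: "{last ys, hd ys} \<in> ?B" if "longest_path V E ys" "{last ys, hd ys} \<in> G" for ys
  proof -
    have "m < card (last ` {zs. rotation E ys zs})" "last ` {zs. rotation E ys zs} \<subseteq> set ys"
      using card_rotation_ends assms that by blast+
    then have "m < card (set ys)" by (meson List.finite_set card_mono order_less_le_trans)
    then have "length ys \<ge> 3" using card_length[of ys] \<open>m \<ge> 2\<close> by linarith
    then show ?thesis
      using deficit_close_path[OF assms(1,3) _ nonham that(1)] that(2) assms(4)
      by (auto simp: expander_def)
  qed
  obtain xs where xs: "longest_path V E xs" using ex_longest_path[OF assms(1)] .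
  define X where "X = last ` {ys. rotation E xs ys}"
  have mX: "m < card X" using card_rotation_ends assms xs unfolding X_def by blast
  then have "finite X" using card.infinite by fastforce
  define Y where "Y x = {y. {x, y} \<in> ?B}" for x
  have finY: "finite (Y x)" for x
    by (rule finite_subset[OF _ \<open>finite V\<close>]) (use G(2) in \<open>auto simp: Y_def\<close>)
  have Y: "m + 1 - r \<le> card (Y x)" if "x \<in> X" for x
  proof -
    from that obtain ys where ys: "rotation E xs ys" "x = last ys" by (auto simp: X_def)
    then have "longest_path V E ys" using rotation_longest_path xs by blast
    \<comment> \<open>Reversal puts \<open>x\<close> first, where rotations keep it fixed.\<close>
    then have long: "longest_path V E (rev ys)" by (simp add: longest_path_rev)
    have "rev ys \<noteq> []" using longest_path_nonempty[OF long] assms by blast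
    define Z where "Z = last ` {zs. rotation E (rev ys) zs}"
    have Z: "m < card Z" "Z \<subseteq> set (rev ys)"
      using card_rotation_ends[OF long] assms unfolding Z_def by blast+
    then have "Z \<subseteq> V" using long by (auto simp: longest_path_def edge_path_def)
    have "Z \<inter> {u. {x, u} \<in> G} \<subseteq> Y x"
    proof
      fix y assume "y \<in> Z \<inter> {u. {x, u} \<in> G}"
      then obtain zs where zs: "rotation E (rev ys) zs" "y = last zs" "{x, y} \<in> G"
        by (auto simp: Z_def)
      then have "longest_path V E zs" using rotation_longest_path long by blast
      moreover have "hd zs = x"
        using rotation_edge_path[OF zs(1), of V] long \<open>rev ys \<noteq> []\<close> ys
        by (simp add: longest_path_def hd_rev)
      ultimately show "y \<in> Y x"
        using boost[of zs] zs by (simp add: Y_def insert_commute)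
    qed
    then have "card (Z \<inter> {u. {x, u} \<in> G}) \<le> card (Y x)"
      by (intro card_mono finY)
    moreover have "card Z \<le> card (Z \<inter> {u. {x, u} \<in> G}) + card (V - {u. {x, u} \<in> G})"
    proof -
      have "card Z \<le> card ((Z \<inter> {u. {x, u} \<in> G}) \<union> (V - {u. {x, u} \<in> G}))"
        using \<open>Z \<subseteq> V\<close> assms(1) by (intro card_mono) (auto intro: finite_subset)
      also have "\<dots> \<le> card (Z \<inter> {u. {x, u} \<in> G}) + card (V - {u. {x, u} \<in> G})"
        by (rule card_Un_le)
      finally show ?thesis .
    qed
    moreover have "x \<in> V"
      using \<open>longest_path V E ys\<close> \<open>rev ys \<noteq> []\<close> ys(2)
      by (auto simp: longest_path_def edge_path_def)
    ultimately show ?thesis using G(3)[of x] Z(1) by linarith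
  qed
  have "(m + 1) * (m + 1 - r) \<le> card X * (m + 1 - r)" using mX by (intro mult_right_mono) auto
  also have "\<dots> \<le> (\<Sum>x\<in>X. card (Y x))" using sum_mono[OF Y] by simp
  also have "\<dots> = card (SIGMA x:X. Y x)"
    using \<open>finite X\<close> finY by (simp add: card_SigmaI)
  also have "\<dots> \<le> card (\<Union>e\<in>?B. {(x, y). {x, y} = e})"
    using G(1) doubleton_pairs(1) by (intro card_mono) (auto simp: Y_def)
  also have "\<dots> \<le> (\<Sum>e\<in>?B. card {(x, y). {x, y} = e})"
    using G(1) by (intro card_UN_le) auto
  also have "\<dots> \<le> (\<Sum>e\<in>?B. 2)"
    by (intro sum_mono doubleton_pairs)
  finally show ?thesis by simp
qed

section \<open>Random edge sets and sprinkling\<close>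

definition random_subset :: "'a set \<Rightarrow> real \<Rightarrow> 'a set pmf" where
  "random_subset E p = map_pmf (\<lambda>f. {e \<in> E. f e}) (Pi_pmf E False (\<lambda>_. bernoulli_pmf p))"

lemma random_subgraph_eq:
  "random_subgraph G p = map_pmf (Graph (verts G)) (random_subset (edges G) p)"
  by (simp add: random_subgraph_def random_subset_def pmf.map_comp o_def)

lemma set_random_subset: "H \<in> set_pmf (random_subset E p) \<Longrightarrow> H \<subseteq> E"
  by (auto simp: random_subset_def)

lemma bernoulli_or:
  fixes p q :: real
  assumes "0 \<le> p" "p \<le> 1" "0 \<le> q" "q \<le> 1"
  shows "bernoulli_pmf (1 - (1 - p) * (1 - q)) =
    bernoulli_pmf p \<bind> (\<lambda>b. bernoulli_pmf q \<bind> (\<lambda>c. return_pmf (b \<or> c)))"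
proof -
  have r: "0 \<le> (1 - p) * (1 - q)" "(1 - p) * (1 - q) \<le> 1"
    using assms by (simp_all add: mult_le_one)
  show ?thesis
  proof (rule pmf_eqI)
    fix b :: bool
    show "pmf (bernoulli_pmf (1 - (1 - p) * (1 - q))) b =
      pmf (bernoulli_pmf p \<bind> (\<lambda>b. bernoulli_pmf q \<bind> (\<lambda>c. return_pmf (b \<or> c)))) b"
      using assms r by (cases b) (simp_all add: pmf_bind algebra_simps)
  qed
qed

text \<open>An edge is absent from the union exactly when both independent rounds miss it, and this
  holds independently for each edge.\<close>

lemma random_subset_Un:
  fixes p q :: real
  assumes "finite E" "0 \<le> p" "p \<le> 1" "0 \<le> q" "q \<le> 1"
  shows "random_subset E (1 - (1 - p) * (1 - q)) =
    random_subset E p \<bind> (\<lambda>A. map_pmf (\<lambda>B. A \<union> B) (random_subset E q))"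
proof -
  have "Pi_pmf E False (\<lambda>_. bernoulli_pmf (1 - (1 - p) * (1 - q))) =
    Pi_pmf E False (\<lambda>_. bernoulli_pmf p) \<bind> (\<lambda>f. Pi_pmf E False (\<lambda>_. bernoulli_pmf q) \<bind>
      (\<lambda>g. return_pmf (\<lambda>x. if x \<in> E then f x \<or> g x else False)))"
    using assms by (simp add: bernoulli_or Pi_pmf_bind[where d' = False])
  then show ?thesis
    unfolding random_subset_def
    by (auto simp: map_pmf_def bind_assoc_pmf bind_return_pmf
        intro!: bind_pmf_cong arg_cong[of _ _ return_pmf])
qed

text \<open>The event is a cylinder: each edge is forced in, forced out or left free, so its
  probability factorises over the edges.\<close>

lemma prob_random_subset:
  fixes p :: real
  assumes "finite E" "F \<subseteq> E" "D \<subseteq> E" "F \<inter> D = {}" "0 \<le> p" "p \<le> 1"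
  shows "measure_pmf.prob (random_subset E p) {H. F \<subseteq> H \<and> D \<inter> H = {}} =
    p ^ card F * (1 - p) ^ card D"
proof -
  define B where "B e = (if e \<in> F then {True} else if e \<in> D then {False} else UNIV)" for e
  have *: "(\<lambda>f. {e \<in> E. f e}) -` {H. F \<subseteq> H \<and> D \<inter> H = {}} = Pi E B"
    using assms(2-4) by (fastforce simp: B_def Pi_def split: if_splits)
  have "measure_pmf.prob (random_subset E p) {H. F \<subseteq> H \<and> D \<inter> H = {}} =
    (\<Prod>e\<in>E. measure_pmf.prob (bernoulli_pmf p) (B e))"
    unfolding random_subset_def measure_map_pmf * using assms(1) by (rule measure_Pi_pmf_Pi)
  also have "\<dots> = (\<Prod>e\<in>E. (if e \<in> F then p else 1) * (if e \<in> D then 1 - p else 1))"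
    using assms(4-6) by (intro prod.cong) (auto simp: B_def measure_pmf_single)
  also have "\<dots> = p ^ card F * (1 - p) ^ card D"
    using assms(1-3) by (simp add: prod.distrib prod.If_cases Int_absorb1)
  finally show ?thesis .
qed

lemma prob_bind:
  "measure_pmf.prob (bind_pmf M f) A = measure_pmf.expectation M (\<lambda>x. measure_pmf.prob (f x) A)"
  unfolding measure_pmf_bind
  by (subst measure_pmf.measure_bind[where N = "count_space UNIV"]) (auto simp: measure_subprob)

lemma finite_set_random_subset: "finite E \<Longrightarrow> finite (set_pmf (random_subset E p))"
  by (rule finite_subset[of _ "Pow E"]) (auto dest: set_random_subset)

text \<open>The bound satisfies the recursion $f(d, R + 1) = \delta f(d, R) + f(d - 1, R)$ obtained by
  conditioning on whether the first round hits a booster; the weight $x$ is free.\<close>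

lemma sprinkling:
  fixes q x \<delta> :: real
  assumes "finite V" "finite E" "0 \<le> q" "q \<le> 1" "1 \<le> x" "0 \<le> \<delta>"
    and boosters: "\<And>\<Gamma>. P \<Gamma> \<Longrightarrow> \<not> hamiltonian (Graph V \<Gamma>) \<Longrightarrow>
      (1 - q) ^ card {e\<in>E. deficit V (insert e \<Gamma>) < deficit V \<Gamma>} \<le> \<delta>"
    and up: "\<And>\<Gamma> H. P \<Gamma> \<Longrightarrow> H \<subseteq> E \<Longrightarrow> P (\<Gamma> \<union> H)"
    and "P \<Gamma>"
  shows "measure_pmf.prob (random_subset E (1 - (1 - q) ^ R)) {H. \<not> hamiltonian (Graph V (\<Gamma> \<union> H))}
    \<le> x ^ deficit V \<Gamma> * (\<delta> + 1 / x) ^ R"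
  using \<open>P \<Gamma>\<close>
proof (induction R arbitrary: \<Gamma>)
  case 0
  show ?case using \<open>1 \<le> x\<close> by (simp add: order_trans[OF measure_pmf.prob_le_1])
next
  case (Suc R)
  let ?c = "(\<delta> + 1 / x) ^ R" and ?d = "deficit V \<Gamma>"
  have c: "0 \<le> ?c" using \<open>0 \<le> \<delta>\<close> \<open>1 \<le> x\<close> by simp
  show ?case
  proof (cases "hamiltonian (Graph V \<Gamma>)")
    case True
    then have "{H. \<not> hamiltonian (Graph V (\<Gamma> \<union> H))} = {}" using hamiltonian_mono by blast
    then show ?thesis using \<open>0 \<le> \<delta>\<close> \<open>1 \<le> x\<close> by simp
  next
    case False
    define B where "B = {e\<in>E. deficit V (insert e \<Gamma>) < deficit V \<Gamma>}"
    have R: "0 \<le> 1 - (1 - q) ^ R" "1 - (1 - q) ^ R \<le> 1"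
      using assms(3,4) by (auto simp: power_le_one)
    have "?d \<noteq> 0" using False deficit_eq_0[OF assms(1)] by simp
    \<comment> \<open>The first round is exposed separately; the other \<open>R\<close> rounds then
      act on \<open>\<Gamma> \<union> A\<close>.\<close>
    have "1 - (1 - q) ^ Suc R = 1 - (1 - q) * (1 - (1 - (1 - q) ^ R))" by simp
    then have "measure_pmf.prob (random_subset E (1 - (1 - q) ^ Suc R))
        {H. \<not> hamiltonian (Graph V (\<Gamma> \<union> H))} =
      measure_pmf.expectation (random_subset E q) (\<lambda>A.
        measure_pmf.prob (random_subset E (1 - (1 - q) ^ R)) {H. \<not> hamiltonian (Graph V ((\<Gamma> \<union> A) \<union> H))})"
      using random_subset_Un[OF assms(2-4) R] by (simp add: prob_bind vimage_def Un_assoc)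
    \<comment> \<open>A round \<open>A\<close> that misses all boosters \<open>B\<close> does not
      raise the deficit; a round that hits one lowers it by at least 1. The sum of the two weights
      covers both cases.\<close>
    also have "\<dots> \<le> measure_pmf.expectation (random_subset E q) (\<lambda>A.
        (x ^ ?d * indicator {H. {} \<subseteq> H \<and> B \<inter> H = {}} A + x ^ (?d - 1)) * ?c)"
    proof (rule integral_mono_AE)
      show "AE A in random_subset E q.
        measure_pmf.prob (random_subset E (1 - (1 - q) ^ R)) {H. \<not> hamiltonian (Graph V ((\<Gamma> \<union> A) \<union> H))}
        \<le> (x ^ ?d * indicator {H. {} \<subseteq> H \<and> B \<inter> H = {}} A + x ^ (?d - 1)) * ?c"
      proof (subst AE_measure_pmf_iff, intro ballI)
        fix A assume "A \<in> set_pmf (random_subset E q)"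
        then have "A \<subseteq> E" by (rule set_random_subset)
        then have "measure_pmf.prob (random_subset E (1 - (1 - q) ^ R))
            {H. \<not> hamiltonian (Graph V ((\<Gamma> \<union> A) \<union> H))} \<le> x ^ deficit V (\<Gamma> \<union> A) * ?c"
          using Suc up by blast
        also have "x ^ deficit V (\<Gamma> \<union> A) \<le>
          x ^ ?d * indicator {H. {} \<subseteq> H \<and> B \<inter> H = {}} A + x ^ (?d - 1)"
        proof (cases "B \<inter> A = {}")
          case True
          have "x ^ deficit V (\<Gamma> \<union> A) \<le> x ^ ?d"
            using \<open>1 \<le> x\<close> deficit_mono[OF assms(1)] by (intro power_increasing) auto
          then show ?thesis using True \<open>1 \<le> x\<close> by (simp add: add_increasing2)
        next
          case False
          then obtain e where "e \<in> B" "e \<in> A" by blast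
          then have "deficit V (\<Gamma> \<union> A) \<le> deficit V (insert e \<Gamma>)" "deficit V (insert e \<Gamma>) < ?d"
            using deficit_mono[OF assms(1), of "insert e \<Gamma>" "\<Gamma> \<union> A"] by (auto simp: B_def)
          then have "deficit V (\<Gamma> \<union> A) \<le> ?d - 1" by linarith
          then show ?thesis using False \<open>1 \<le> x\<close> by (simp add: power_increasing)
        qed
        finally show "measure_pmf.prob (random_subset E (1 - (1 - q) ^ R))
            {H. \<not> hamiltonian (Graph V ((\<Gamma> \<union> A) \<union> H))}
          \<le> (x ^ ?d * indicator {H. {} \<subseteq> H \<and> B \<inter> H = {}} A + x ^ (?d - 1)) * ?c"
          using c by (simp add: mult_right_mono)
      qed
    qed (auto intro!: integrable_measure_pmf_finite finite_set_random_subset assms(2))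
    also have "\<dots> = (x ^ ?d * measure_pmf.prob (random_subset E q) {H. {} \<subseteq> H \<and> B \<inter> H = {}} + x ^ (?d - 1)) * ?c"
      using finite_set_random_subset[OF assms(2), of q]
      by (subst integral_mult_left_zero, subst Bochner_Integration.integral_add)
        (auto intro!: integrable_measure_pmf_finite)
    also have "measure_pmf.prob (random_subset E q) {H. {} \<subseteq> H \<and> B \<inter> H = {}} = (1 - q) ^ card B"
      using prob_random_subset[of E "{}" B q] assms by (simp add: B_def)
    also have "(x ^ ?d * (1 - q) ^ card B + x ^ (?d - 1)) * ?c \<le> (x ^ ?d * \<delta> + x ^ (?d - 1)) * ?c"
      using boosters[OF Suc.prems False] \<open>1 \<le> x\<close> c unfolding B_def
      by (intro mult_right_mono add_right_mono mult_left_mono) auto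
    \<comment> \<open>The deficit is positive here, so the truncated subtraction is a true
      predecessor and one success is worth a factor \<open>1 / x\<close>.\<close>
    also have "x ^ (?d - 1) = x ^ ?d * (1 / x)"
      using \<open>?d \<noteq> 0\<close> \<open>1 \<le> x\<close> by (cases ?d) auto
    finally show ?thesis by (simp add: algebra_simps)
  qed
qed

section \<open>Expansion of the random subgraph\<close>

text \<open>These are the edges that must all be absent for the neighbourhood of \<open>S\<close> to
  lie within \<open>T\<close>.\<close>

definition edge_cut :: "'a set set \<Rightarrow> 'a set \<Rightarrow> 'a set \<Rightarrow> 'a set set" where
  "edge_cut E S T = {e\<in>E. \<exists>v\<in>S. \<exists>u. u \<notin> S \<union> T \<and> e = {v, u}}"

text \<open>Each vertex of \<open>S\<close> loses at most \<open>card S + card T\<close> of its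
  neighbours to \<open>S \<union> T\<close>. A cut edge has only one end in \<open>S\<close>, so no
  edge is counted twice.\<close>

lemma card_edge_cut:
  fixes D :: real
  assumes "finite V" "\<And>e. e \<in> E \<Longrightarrow> e \<subseteq> V" "S \<subseteq> V" "T \<subseteq> V"
    and deg: "\<And>v. v \<in> V \<Longrightarrow> D \<le> card {u. {v, u} \<in> E}"
  shows "card S * (D - card S - card T) \<le> card (edge_cut E S T)"
proof -
  have fin: "finite S" "finite T" using assms finite_subset by metis+
  define N where "N v = {u. {v, u} \<in> E} - (S \<union> T)" for v
  have finN: "finite {u. {v, u} \<in> E}" for v
    by (rule finite_subset[OF _ \<open>finite V\<close>]) (use assms(2) in blast)
  have "E \<subseteq> Pow V" using assms(2) by blast
  then have finE: "finite E" using \<open>finite V\<close> by (meson finite_Pow_iff finite_subset)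
  have N: "D - card S - card T \<le> card (N v)" if "v \<in> S" for v
  proof -
    have "card {u. {v, u} \<in> E} \<le> card (N v \<union> (S \<union> T))"
      using fin finN by (intro card_mono) (auto simp: N_def)
    also have "\<dots> \<le> card (N v) + (card S + card T)"
      by (meson card_Un_le add_left_mono order_trans)
    finally have "card {u. {v, u} \<in> E} \<le> card (N v) + (card S + card T)" .
    then show ?thesis using deg[of v] that assms(3) by force
  qed
  have "card S * (D - card S - card T) \<le> (\<Sum>v\<in>S. real (card (N v)))"
    using sum_mono[OF N, of S "\<lambda>x. x"] by simp
  also have "\<dots> = card (SIGMA v:S. N v)"
    using fin finN by (simp add: N_def)
  also have "\<dots> \<le> card (edge_cut E S T)"
    unfolding of_nat_le_iff
  proof (rule card_inj_on_le[of "\<lambda>(v, u). {v, u}"])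
    show "inj_on (\<lambda>(v, u). {v, u}) (SIGMA v:S. N v)"
      by (auto simp: inj_on_def N_def doubleton_eq_iff)
    show "(\<lambda>(v, u). {v, u}) ` (SIGMA v:S. N v) \<subseteq> edge_cut E S T"
      by (auto simp: N_def edge_cut_def)
    show "finite (edge_cut E S T)" using finE by (simp add: edge_cut_def)
  qed
  finally show ?thesis .
qed

lemma prob_nbh_eq:
  fixes p :: real
  assumes "finite E" "finite S" "finite T" "S \<inter> T = {}" "0 \<le> p" "p \<le> 1"
  shows "measure_pmf.prob (random_subset E p) {H. nbh H S = T} \<le>
    (card S * p) ^ card T * (1 - p) ^ card (edge_cut E S T)"
proof -
  \<comment> \<open>Fixing for each target the edge that reaches it makes the event a cylinder.\<close>
  define F where "F w = (\<lambda>v. {w v, v}) ` T" for w :: "'a \<Rightarrow> 'a"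
  define W where "W = {w \<in> T \<rightarrow>\<^sub>E S. F w \<subseteq> E}"
  let ?ev = "\<lambda>w. {H. F w \<subseteq> H \<and> edge_cut E S T \<inter> H = {}}"
  have finW: "finite W" unfolding W_def using assms by (simp add: finite_PiE)
  have "card W \<le> card (T \<rightarrow>\<^sub>E S)"
    unfolding W_def using assms by (intro card_mono) (auto simp: finite_PiE)
  then have cardW: "card W \<le> card S ^ card T" using assms by (simp add: card_PiE)
  have ev: "measure_pmf.prob (random_subset E p) (?ev w) = p ^ card T * (1 - p) ^ card (edge_cut E S T)"
    if "w \<in> W" for w
  proof -
    have "w v \<in> S" if "v \<in> T" for v using \<open>w \<in> W\<close> that by (auto simp: W_def)
    \<comment> \<open>As \<open>S\<close> and \<open>T\<close> are disjoint, distinct targets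
      receive distinct edges. Both ends of such an edge lie in \<open>S \<union> T\<close>, so it
      avoids the cut.\<close>
    then have "inj_on (\<lambda>v. {w v, v}) T" "F w \<inter> edge_cut E S T = {}"
      using assms(4) by (auto simp: inj_on_def doubleton_eq_iff F_def edge_cut_def)
    moreover have "edge_cut E S T \<subseteq> E" by (auto simp: edge_cut_def)
    moreover have "F w \<subseteq> E" using that by (simp add: W_def)
    ultimately show ?thesis
      using prob_random_subset[of E "F w" "edge_cut E S T" p] assms by (simp add: F_def card_image)
  qed
  have "measure_pmf.prob (random_subset E p) {H. nbh H S = T} =
    measure_pmf.prob (random_subset E p) ({H. nbh H S = T} \<inter> set_pmf (random_subset E p))"
    by (simp add: measure_Int_set_pmf)
  also have "\<dots> \<le> measure_pmf.prob (random_subset E p) (\<Union>w\<in>W. ?ev w)"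
  proof (rule measure_pmf.finite_measure_mono)
    show "{H. nbh H S = T} \<inter> set_pmf (random_subset E p) \<subseteq> (\<Union>w\<in>W. ?ev w)"
    proof
      fix H assume "H \<in> {H. nbh H S = T} \<inter> set_pmf (random_subset E p)"
      then have H: "nbh H S = T" "H \<subseteq> E" by (auto dest: set_random_subset)
      then have "\<forall>v\<in>T. \<exists>u\<in>S. {u, v} \<in> H" by (auto simp: nbh_def)
      then obtain w where w: "\<And>v. v \<in> T \<Longrightarrow> w v \<in> S \<and> {w v, v} \<in> H" by metis
      then have "F (restrict w T) \<subseteq> H" by (auto simp: F_def)
      then have "restrict w T \<in> W" using w H(2) by (auto simp: W_def)
      moreover have "edge_cut E S T \<inter> H = {}" using H(1) by (auto simp: edge_cut_def nbh_def)
      ultimately show "H \<in> (\<Union>w\<in>W. ?ev w)" using \<open>F (restrict w T) \<subseteq> H\<close> by blast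
    qed
  qed simp
  also have "\<dots> \<le> (\<Sum>w\<in>W. measure_pmf.prob (random_subset E p) (?ev w))"
    using finW by (intro measure_pmf.finite_measure_subadditive_finite) auto
  also have "\<dots> = card W * (p ^ card T * (1 - p) ^ card (edge_cut E S T))" using ev by simp
  also have "\<dots> \<le> (card S ^ card T) * (p ^ card T * (1 - p) ^ card (edge_cut E S T))"
    using cardW assms by (intro mult_right_mono) (simp_all flip: of_nat_power)
  finally show ?thesis by (simp add: power_mult_distrib mult.assoc)
qed

section \<open>Union bound for the failure of expansion\<close>

lemma power_le_exp:
  fixes p :: real
  assumes "0 \<le> p" "p \<le> 1"
  shows "(1 - p) ^ n \<le> exp (- p * n)"
proof -
  have "(1 - p) ^ n \<le> exp (- p) ^ n"
    using assms exp_ge_add_one_self[of "- p"] by (intro power_mono) auto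
  then show ?thesis by (simp add: exp_of_nat_mult mult.commute flip: exp_of_nat_mult)
qed

lemma sum_Pow_power:
  fixes x :: real
  assumes "finite V"
  shows "(\<Sum>S\<in>Pow V. x ^ card S) = (1 + x) ^ card V"
  using prod_add[OF assms, of "\<lambda>_. x" "\<lambda>_. 1"] by (simp add: add.commute)

text \<open>With n for \<open>card V\<close>, write sp = (pn)(s/n). Since pn is at least 1, the
  first factors contribute at most (pn)^(2s); the second ones, summed over all subsets, give (1 +
  s/n)^n, which is at most e^s. No binomial coefficient needs estimating.\<close>

lemma sum_small_targets:
  fixes p :: real
  assumes "finite V" "0 \<le> p" "1 \<le> p * card V"
  shows "(\<Sum>T\<in>{T\<in>Pow V. card T \<le> 2 * s}. (s * p) ^ card T) \<le> ((p * card V)\<^sup>2 * exp 1) ^ s"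
proof -
  let ?n = "card V"
  have n: "?n > 0" using assms(3) by (cases "?n = 0") auto
  have "(\<Sum>T\<in>{T\<in>Pow V. card T \<le> 2 * s}. (s * p) ^ card T) \<le>
    (\<Sum>T\<in>{T\<in>Pow V. card T \<le> 2 * s}. (p * ?n) ^ (2 * s) * (s / ?n) ^ card T)"
  proof (rule sum_mono)
    fix T assume T: "T \<in> {T\<in>Pow V. card T \<le> 2 * s}"
    have "(s * p) ^ card T = (p * ?n) ^ card T * (s / ?n) ^ card T"
      using n by (simp add: mult.commute flip: power_mult_distrib)
    also have "\<dots> \<le> (p * ?n) ^ (2 * s) * (s / ?n) ^ card T"
      using T assms by (intro mult_right_mono power_increasing) auto
    finally show "(s * p) ^ card T \<le> (p * ?n) ^ (2 * s) * (s / ?n) ^ card T" .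
  qed
  also have "\<dots> = (p * ?n) ^ (2 * s) * (\<Sum>T\<in>{T\<in>Pow V. card T \<le> 2 * s}. (s / ?n) ^ card T)"
    by (simp add: sum_distrib_left)
  also have "\<dots> \<le> (p * ?n) ^ (2 * s) * (\<Sum>T\<in>Pow V. (s / ?n) ^ card T)"
    using assms by (intro mult_left_mono sum_mono2) auto
  also have "(\<Sum>T\<in>Pow V. (s / ?n) ^ card T) = (1 + s / ?n) ^ ?n" by (rule sum_Pow_power[OF assms(1)])
  also have "\<dots> \<le> exp (s / ?n) ^ ?n" by (intro power_mono exp_ge_add_one_self) auto
  also have "\<dots> = exp 1 ^ s" using n by (simp flip: exp_of_nat_mult)
  finally show ?thesis
    using assms by (simp add: power_mult power_mult_distrib mult_left_mono)
qed

text \<open>Sets of at most \<open>a\<close> vertices are summed over together with all candidate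
  neighbourhoods, with total at most (1 + z)^n - 1 for one weight z per vertex. Every other bad set
  comes with a cut of at least \<open>W\<close> edges, for which the crude count of 4^n pairs
  suffices.\<close>

lemma prob_not_expander:
  fixes D a W p :: real
  assumes V: "finite V" "\<And>e. e \<in> E \<Longrightarrow> e \<subseteq> V"
    and deg: "\<And>v. v \<in> V \<Longrightarrow> D \<le> card {u. {v, u} \<in> E}"
    and p: "0 \<le> p" "p \<le> 1" "1 \<le> p * card V"
    and large: "\<And>s. a < real s \<Longrightarrow> s \<le> m \<Longrightarrow> W \<le> s * (D - 3 * s)"
    and conn: "\<And>s. m < s \<Longrightarrow> 2 * s \<le> card V \<Longrightarrow> W \<le> s * (D - s)"
  shows "measure_pmf.prob (random_subset E p) {H. \<not> expander V H m} \<le>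
    exp (card V * ((p * card V)\<^sup>2 * exp 1 * exp (- p * (D - 3 * a)))) - 1 +
    4 ^ card V * exp (- p * W)"
proof -
  let ?P = "measure_pmf.prob (random_subset E p)" and ?n = "card V"
  define A where "A = {S\<in>Pow V. S \<noteq> {} \<and> real (card S) \<le> a}"
  define B where "B S = {T\<in>Pow V. S \<inter> T = {} \<and> card T \<le> 2 * card S}" for S
  \<comment> \<open>Serves two purposes: sets of more than \<open>a\<close> and at most
    \<open>m\<close> vertices that fail to expand, and isolated sets of more than \<open>m\<close>
    and at most half of the vertices.\<close>
  define L where "L = {(S, T) \<in> Pow V \<times> Pow V. S \<inter> T = {} \<and> W \<le> card S * (D - card S - card T)}"
  have "E \<subseteq> Pow V" using V(2) by blast
  then have finE: "finite E" using V(1) by (meson finite_Pow_iff finite_subset)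
  have finA: "finite A" "finite (B S)" for S using V(1) by (auto simp: A_def B_def)
  have "L \<subseteq> Pow V \<times> Pow V" by (auto simp: L_def)
  then have finL: "finite L" "card L \<le> 4 ^ ?n"
  proof -
    have "4 ^ ?n = card (Pow V \<times> Pow V)"
      using V(1) by (simp add: card_cartesian_product card_Pow flip: power_mult_distrib)
    moreover have "finite (Pow V \<times> Pow V)" using V(1) by simp
    ultimately show "finite L" "card L \<le> 4 ^ ?n"
      using \<open>L \<subseteq> _\<close> by (metis finite_subset, metis card_mono)
  qed
  have fin: "finite S" if "S \<subseteq> V" for S using that V(1) finite_subset by blast
  have cut_exp: "(1 - p) ^ card (edge_cut E S T) \<le> exp (- p * (card S * (D - card S - card T)))"
    if "S \<subseteq> V" "T \<subseteq> V" for S T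
  proof -
    have "(1 - p) ^ card (edge_cut E S T) \<le> exp (- p * card (edge_cut E S T))"
      using p by (intro power_le_exp) auto
    also have "\<dots> \<le> exp (- p * (card S * (D - card S - card T)))"
      using card_edge_cut[OF V that deg] p by (simp add: mult_left_mono)
    finally show ?thesis .
  qed
  have "?P {H. \<not> expander V H m} = ?P ({H. \<not> expander V H m} \<inter> set_pmf (random_subset E p))"
    by (simp add: measure_Int_set_pmf)
  also have "\<dots> \<le> ?P ((\<Union>S\<in>A. \<Union>T\<in>B S. {H. nbh H S = T}) \<union> (\<Union>(S, T)\<in>L. {H. nbh H S = T}))"
  proof (rule measure_pmf.finite_measure_mono, rule subsetI)
    fix H assume "H \<in> {H. \<not> expander V H m} \<inter> set_pmf (random_subset E p)"
    then have H: "\<not> expander V H m" "H \<subseteq> E" by (auto dest: set_random_subset)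
    have N: "nbh H S \<subseteq> V" "S \<inter> nbh H S = {}" for S
      using nbh_subset[of H V S] H(2) V(2) by (auto simp: nbh_def)
    have small: "\<exists>S. (S \<in> A \<and> nbh H S \<in> B S) \<or> (S, nbh H S) \<in> L"
      if "S \<subseteq> V" "S \<noteq> {}" "card S \<le> m" "card (nbh H S) \<le> 2 * card S" for S
    proof (cases "real (card S) \<le> a")
      case True
      then show ?thesis using that N by (auto simp: A_def B_def)
    next
      case False
      then have "W \<le> card S * (D - 3 * card S)" using large that by simp
      also have "\<dots> \<le> card S * (D - card S - card (nbh H S))"
        using that(4) by (intro mult_left_mono) auto
      finally show ?thesis using that N by (auto simp: L_def)
    qed
    have half: "\<exists>S. (S \<in> A \<and> nbh H S \<in> B S) \<or> (S, nbh H S) \<in> L"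
      if "S \<subseteq> V" "S \<noteq> {}" "2 * card S \<le> ?n" "nbh H S = {}" for S
    proof (cases "card S \<le> m")
      case True
      then show ?thesis using small that by simp
    next
      case False
      then have "W \<le> card S * (D - card S)" using conn that by simp
      then show ?thesis using that by (auto simp: L_def intro!: exI[of _ S])
    qed
    from H(1) consider S where "S \<subseteq> V" "S \<noteq> {}" "card S \<le> m" "card (nbh H S) \<le> 2 * card S"
      | S where "S \<subseteq> V" "S \<noteq> {}" "S \<noteq> V" "nbh H S = {}"
      unfolding expander_def by (metis leI)
    then have "\<exists>S. (S \<in> A \<and> nbh H S \<in> B S) \<or> (S, nbh H S) \<in> L"
    proof cases
      case 1
      then show ?thesis by (rule small)
    next
      case (2 S)
      \<comment> \<open>A set without outside neighbours has a complement without outside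
        neighbours, so the smaller of the two can be used.\<close>
      have "nbh H (V - S) = {}"
      proof (rule ccontr)
        assume "nbh H (V - S) \<noteq> {}"
        then obtain u v where "u \<notin> V - S" "v \<in> V - S" "{v, u} \<in> H" by (auto simp: nbh_def)
        moreover then have "u \<in> S" using H(2) V(2) by blast
        ultimately have "v \<in> nbh H S" by (auto simp: nbh_def insert_commute)
        then show False using 2 by simp
      qed
      moreover have "card S + card (V - S) = ?n"
        using 2 V(1) by (simp add: card_Diff_subset fin card_mono)
      ultimately show ?thesis
        using half[of S] half[of "V - S"] 2 by (cases "2 * card S \<le> ?n") auto
    qed
    then show "H \<in> (\<Union>S\<in>A. \<Union>T\<in>B S. {H. nbh H S = T}) \<union> (\<Union>(S, T)\<in>L. {H. nbh H S = T})"
      by blast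
  qed simp
  also have "\<dots> \<le> ?P (\<Union>S\<in>A. \<Union>T\<in>B S. {H. nbh H S = T}) + ?P (\<Union>(S, T)\<in>L. {H. nbh H S = T})"
    by (rule measure_Un_le) auto
  also have "?P (\<Union>S\<in>A. \<Union>T\<in>B S. {H. nbh H S = T}) \<le> (\<Sum>S\<in>A. ?P (\<Union>T\<in>B S. {H. nbh H S = T}))"
    using finA by (intro measure_pmf.finite_measure_subadditive_finite) auto
  also have "\<dots> \<le> (\<Sum>S\<in>A. \<Sum>T\<in>B S. ?P {H. nbh H S = T})"
    using finA by (intro sum_mono measure_pmf.finite_measure_subadditive_finite) auto
  also have "\<dots> \<le> (\<Sum>S\<in>A. ((p * ?n)\<^sup>2 * exp 1 * exp (- p * (D - 3 * a))) ^ card S)"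
  proof (rule sum_mono)
    fix S assume S: "S \<in> A"
    then have SV: "S \<subseteq> V" and Sa: "real (card S) \<le> a" by (auto simp: A_def)
    let ?y = "exp (- p * (D - 3 * a)) ^ card S"
    have "(\<Sum>T\<in>B S. ?P {H. nbh H S = T}) \<le> (\<Sum>T\<in>B S. (card S * p) ^ card T * ?y)"
    proof (rule sum_mono)
      fix T assume T: "T \<in> B S"
      then have TV: "T \<subseteq> V" "S \<inter> T = {}" "card T \<le> 2 * card S" by (auto simp: B_def)
      have "?P {H. nbh H S = T} \<le> (card S * p) ^ card T * (1 - p) ^ card (edge_cut E S T)"
        using prob_nbh_eq[OF finE fin[OF SV] fin[OF TV(1)] TV(2) p(1,2)] .
      also have "(1 - p) ^ card (edge_cut E S T) \<le> exp (- p * (card S * (D - card S - card T)))"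
        using cut_exp SV TV by blast
      \<comment> \<open>Here card S + card T is at most 3 card S, hence at most 3a.\<close>
      also have "\<dots> \<le> exp (- p * (card S * (D - 3 * a)))"
        using Sa TV(3) p by (auto intro!: mult_left_mono)
      also have "\<dots> = ?y" by (simp add: mult.left_commute flip: exp_of_nat_mult)
      finally show "?P {H. nbh H S = T} \<le> (card S * p) ^ card T * ?y"
        using p by (simp add: mult_left_mono)
    qed
    also have "\<dots> = (\<Sum>T\<in>B S. (card S * p) ^ card T) * ?y" by (simp add: sum_distrib_right)
    also have "(\<Sum>T\<in>B S. (card S * p) ^ card T) \<le>
      (\<Sum>T\<in>{T\<in>Pow V. card T \<le> 2 * card S}. (card S * p) ^ card T)"
      using V(1) p by (intro sum_mono2) (auto simp: B_def)
    also have "\<dots> \<le> ((p * ?n)\<^sup>2 * exp 1) ^ card S"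
      by (rule sum_small_targets[OF V(1) p(1,3)])
    finally show "(\<Sum>T\<in>B S. ?P {H. nbh H S = T}) \<le>
      ((p * ?n)\<^sup>2 * exp 1 * exp (- p * (D - 3 * a))) ^ card S"
      by (simp add: power_mult_distrib mult_right_mono)
  qed
  \<comment> \<open>Summing over all nonempty subsets completes the binomial expansion; the final -1
    is the term of the empty set.\<close>
  also have "\<dots> \<le> (\<Sum>S\<in>Pow V - {{}}. ((p * ?n)\<^sup>2 * exp 1 * exp (- p * (D - 3 * a))) ^ card S)"
    using V(1) by (intro sum_mono2) (auto simp: A_def)
  also have "\<dots> = (1 + (p * ?n)\<^sup>2 * exp 1 * exp (- p * (D - 3 * a))) ^ ?n - 1"
    using V(1) sum_Pow_power[OF V(1), of "(p * ?n)\<^sup>2 * exp 1 * exp (- p * (D - 3 * a))"]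
    by (simp add: sum_diff1)
  also have "\<dots> \<le> exp ((p * ?n)\<^sup>2 * exp 1 * exp (- p * (D - 3 * a))) ^ ?n - 1"
    by (intro diff_right_mono power_mono exp_ge_add_one_self) auto
  also have "\<dots> = exp (?n * ((p * ?n)\<^sup>2 * exp 1 * exp (- p * (D - 3 * a)))) - 1"
    by (simp only: exp_of_nat_mult)
  also have "?P (\<Union>(S, T)\<in>L. {H. nbh H S = T}) \<le> 4 ^ ?n * exp (- p * W)"
  proof -
    have "?P (\<Union>(S, T)\<in>L. {H. nbh H S = T}) \<le> (\<Sum>x\<in>L. ?P (case x of (S, T) \<Rightarrow> {H. nbh H S = T}))"
      using finL by (intro measure_pmf.finite_measure_subadditive_finite) auto
    also have "\<dots> \<le> (\<Sum>x\<in>L. exp (- p * W))"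
    proof (rule sum_mono)
      fix x assume "x \<in> L"
      then obtain S T where x: "x = (S, T)" "S \<subseteq> V" "T \<subseteq> V" "S \<inter> T = {}"
        "W \<le> card S * (D - card S - card T)"
        by (auto simp: L_def)
      \<comment> \<open>Only the absence of the cut is kept; that every vertex of \<open>T\<close>
        is reached is discarded.\<close>
      have "?P {H. nbh H S = T} \<le> ?P {H. {} \<subseteq> H \<and> edge_cut E S T \<inter> H = {}}"
        by (intro measure_pmf.finite_measure_mono) (auto simp: edge_cut_def nbh_def)
      also have "\<dots> = (1 - p) ^ card (edge_cut E S T)"
        using prob_random_subset[OF finE, of "{}" "edge_cut E S T" p] p by (simp add: edge_cut_def)
      also have "\<dots> \<le> exp (- p * (card S * (D - card S - card T)))"
        using cut_exp x by blast
      also have "\<dots> \<le> exp (- p * W)"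
        using x(5) p(1) by (simp add: mult_left_mono)
      finally show "?P (case x of (S, T) \<Rightarrow> {H. nbh H S = T}) \<le> exp (- p * W)" by (simp add: x)
    qed
    also have "\<dots> = card L * exp (- p * W)" by simp
    also have "\<dots> \<le> 4 ^ ?n * exp (- p * W)"
    proof (rule mult_right_mono)
      have "real (card L) \<le> real (4 ^ ?n)" using finL(2) by (simp only: of_nat_le_iff)
      then show "real (card L) \<le> 4 ^ ?n" by simp
    qed simp
    finally show ?thesis .
  qed
  finally show ?thesis by (simp add: add_mono)
qed

section \<open>Monotonicity in the density and two-stage exposure\<close>

lemma prob_nonhamiltonian_antimono:
  fixes p p' :: real
  assumes "finite E" "0 \<le> p" "p \<le> p'" "p' \<le> 1"
  shows "measure_pmf.prob (random_subset E p') {H. \<not> hamiltonian (Graph V H)}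
    \<le> measure_pmf.prob (random_subset E p) {H. \<not> hamiltonian (Graph V H)}"
proof -
  \<comment> \<open>Density of a second round that lifts \<open>p\<close> to \<open>p'\<close>;
    Hamiltonicity survives added edges. If \<open>p = 1\<close>, division by zero gives
    \<open>s = 1\<close>, consistent with \<open>p' = 1\<close>.\<close>
  define s where "s = 1 - (1 - p') / (1 - p)"
  have s: "0 \<le> s" "s \<le> 1" "p' = 1 - (1 - p) * (1 - s)"
    using assms by (cases "p = 1"; simp add: s_def)+
  have "measure_pmf.prob (random_subset E p') {H. \<not> hamiltonian (Graph V H)} =
    measure_pmf.expectation (random_subset E p) (\<lambda>A.
      measure_pmf.prob (random_subset E s) {B. \<not> hamiltonian (Graph V (A \<union> B))})"
    using random_subset_Un[OF assms(1,2) _ s(1,2)] assms s(3) by (simp add: prob_bind vimage_def)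
  also have "\<dots> \<le> measure_pmf.expectation (random_subset E p)
    (\<lambda>A. indicator {H. \<not> hamiltonian (Graph V H)} A)"
  proof (rule integral_mono_AE)
    have "measure_pmf.prob (random_subset E s) {B. \<not> hamiltonian (Graph V (A \<union> B))}
      \<le> indicator {H. \<not> hamiltonian (Graph V H)} A" for A
    proof (cases "hamiltonian (Graph V A)")
      case True
      then have "{B. \<not> hamiltonian (Graph V (A \<union> B))} = {}" using hamiltonian_mono by blast
      then show ?thesis by simp
    qed simp
    then show "AE A in random_subset E p.
      measure_pmf.prob (random_subset E s) {B. \<not> hamiltonian (Graph V (A \<union> B))}
      \<le> indicator {H. \<not> hamiltonian (Graph V H)} A" by simp
  qed (auto intro!: integrable_measure_pmf_finite finite_set_random_subset assms(1))
  finally show ?thesis by simp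
qed

text \<open>Expansion has to hold only after the first stage: it persists under sprinkling, so
  \<open>card_boosters\<close> supplies boosters before every round, whatever has been
  added.\<close>

lemma prob_nonhamiltonian:
  fixes p p\<^sub>1 q \<delta> :: real
  assumes V: "finite V" "V \<noteq> {}" "\<And>e. e \<in> E \<Longrightarrow> e \<subseteq> V"
    and r: "\<And>v. v \<in> V \<Longrightarrow> card (V - {u. {v, u} \<in> E}) \<le> r" and m: "2 \<le> m"
    and p: "0 \<le> p\<^sub>1" "0 \<le> q" "q \<le> 1" "p\<^sub>1 + 2 * card V * q \<le> p" "p \<le> 1"
    and \<delta>: "0 < \<delta>" "\<delta> \<le> 1 / 4" "\<And>b. (m + 1) * (m + 1 - r) \<le> 2 * b \<Longrightarrow> (1 - q) ^ b \<le> \<delta>"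
  shows "measure_pmf.prob (random_subset E p) {H. \<not> hamiltonian (Graph V H)} \<le>
    measure_pmf.prob (random_subset E p\<^sub>1) {H. \<not> expander V H m} + 4 * \<delta>"
proof -
  define R where "R = 2 * card V"
  have "E \<subseteq> Pow V" using V(3) by blast
  then have finE: "finite E" using V(1) by (meson finite_Pow_iff finite_subset)
  have "0 \<le> 2 * card V * q" using p by simp
  then have p1: "p\<^sub>1 \<le> 1" using p by linarith
  have q: "0 \<le> 1 - (1 - q) ^ R" "1 - (1 - q) ^ R \<le> 1" using p by (auto simp: power_le_one)
  \<comment> \<open>The exact density of both stages together. Bernoulli's inequality puts it below
    \<open>p\<close>, and monotonicity does the rest.\<close>
  define p\<^sub>0 where "p\<^sub>0 = 1 - (1 - p\<^sub>1) * (1 - (1 - (1 - q) ^ R))"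
  have "1 - R * q \<le> (1 - q) ^ R" using Bernoulli_inequality[of "- q" R] p by simp
  then have "(1 - p\<^sub>1) * (1 - R * q) \<le> (1 - p\<^sub>1) * (1 - q) ^ R"
    using p1 by (intro mult_left_mono) auto
  moreover have "0 \<le> p\<^sub>1 * (R * q)" using p by simp
  ultimately have "p\<^sub>0 \<le> p\<^sub>1 + R * q" by (simp add: p\<^sub>0_def algebra_simps)
  then have "p\<^sub>0 \<le> p" using p by (simp add: R_def)
  moreover have "0 \<le> p\<^sub>0" using p1 p q by (simp add: p\<^sub>0_def mult_le_one power_le_one)
  ultimately have "measure_pmf.prob (random_subset E p) {H. \<not> hamiltonian (Graph V H)} \<le>
    measure_pmf.prob (random_subset E p\<^sub>0) {H. \<not> hamiltonian (Graph V H)}"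
    using prob_nonhamiltonian_antimono[OF finE] p by blast
  also have "\<dots> = measure_pmf.expectation (random_subset E p\<^sub>1) (\<lambda>A.
      measure_pmf.prob (random_subset E (1 - (1 - q) ^ R)) {B. \<not> hamiltonian (Graph V (A \<union> B))})"
    using random_subset_Un[OF finE p(1) p1 q] unfolding p\<^sub>0_def by (simp add: prob_bind vimage_def)
  also have "\<dots> \<le> measure_pmf.expectation (random_subset E p\<^sub>1)
    (\<lambda>A. indicator {H. \<not> expander V H m} A + 4 * \<delta>)"
  proof (rule integral_mono_AE)
    show "AE A in random_subset E p\<^sub>1.
      measure_pmf.prob (random_subset E (1 - (1 - q) ^ R)) {B. \<not> hamiltonian (Graph V (A \<union> B))}
      \<le> indicator {H. \<not> expander V H m} A + 4 * \<delta>"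
    proof (subst AE_measure_pmf_iff, intro ballI)
      fix A assume "A \<in> set_pmf (random_subset E p\<^sub>1)"
      then have A: "A \<subseteq> E" by (rule set_random_subset)
      show "measure_pmf.prob (random_subset E (1 - (1 - q) ^ R)) {B. \<not> hamiltonian (Graph V (A \<union> B))}
        \<le> indicator {H. \<not> expander V H m} A + 4 * \<delta>"
      proof (cases "expander V A m")
        case False
        then show ?thesis
          using \<delta>(1) by (simp add: order_trans[OF measure_pmf.prob_le_1])
      next
        case True
        \<comment> \<open>The weight \<open>1 / \<delta>\<close> makes the two summands in the base
          equal. Two rounds per vertex then leave a factor \<open>4 * \<delta>\<close> for each
          vertex.\<close>
        have "measure_pmf.prob (random_subset E (1 - (1 - q) ^ R)) {B. \<not> hamiltonian (Graph V (A \<union> B))}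
          \<le> (1 / \<delta>) ^ deficit V A * (\<delta> + 1 / (1 / \<delta>)) ^ R"
        proof (rule sprinkling[where P = "\<lambda>\<Gamma>. \<Gamma> \<subseteq> E \<and> expander V \<Gamma> m"])
          fix \<Gamma> assume \<Gamma>: "\<Gamma> \<subseteq> E \<and> expander V \<Gamma> m" "\<not> hamiltonian (Graph V \<Gamma>)"
          then show "(1 - q) ^ card {e\<in>E. deficit V (insert e \<Gamma>) < deficit V \<Gamma>} \<le> \<delta>"
            using V by (intro \<delta>(3) card_boosters[OF V(1,2) _ _ m _ finE V(3) r]) auto
        next
          fix \<Gamma> H assume "\<Gamma> \<subseteq> E \<and> expander V \<Gamma> m" "H \<subseteq> E"
          then show "\<Gamma> \<union> H \<subseteq> E \<and> expander V (\<Gamma> \<union> H) m"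
            using expander_mono[of V \<Gamma> m "\<Gamma> \<union> H"] V by blast
        qed (use p \<delta> V finE A True in \<open>auto simp: field_simps\<close>)
        also have "\<dots> \<le> (1 / \<delta>) ^ card V * (\<delta> + 1 / (1 / \<delta>)) ^ R"
          using \<delta> deficit_le_card[OF V(1,2)]
          by (intro mult_right_mono power_increasing) (auto simp: field_simps)
        also have "\<dots> = ((1 / \<delta>) * (2 * \<delta>)\<^sup>2) ^ card V"
        proof -
          have "\<delta> + 1 / (1 / \<delta>) = 2 * \<delta>" by simp
          then show ?thesis by (simp only: R_def power_mult power_mult_distrib)
        qed
        also have "(1 / \<delta>) * (2 * \<delta>)\<^sup>2 = 4 * \<delta>" using \<delta>(1) by (simp add: power2_eq_square)
        also have "(4 * \<delta>) ^ card V \<le> (4 * \<delta>) ^ 1"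
          using \<delta> V by (intro power_decreasing) (auto simp: card_gt_0_iff Suc_le_eq)
        finally show ?thesis using True by simp
      qed
    qed
  qed (auto intro!: integrable_measure_pmf_finite finite_set_random_subset finE)
  also have "\<dots> = measure_pmf.prob (random_subset E p\<^sub>1) {H. \<not> expander V H m} + 4 * \<delta>"
    using finite_set_random_subset[OF finE, of p\<^sub>1]
    by (subst Bochner_Integration.integral_add) (auto intro!: integrable_measure_pmf_finite)
  finally show ?thesis .
qed

section \<open>Asymptotics\<close>

text \<open>The summands belong, in order, to sets of at most \<open>\<epsilon> * k / 10\<close>
  vertices, to larger sets and connectivity, and to sprinkling.\<close>

definition failure_bound :: "real \<Rightarrow> real \<Rightarrow> real" where
  "failure_bound \<epsilon> k =
     exp (2 * k * ((2 * ln k)\<^sup>2 * exp 1 * k powr (- 1 - \<epsilon>))) - 1 +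
     exp (2 * k * ln 4) * exp (- (\<epsilon> * k * ln k / 20)) + 4 * exp (- (\<epsilon> * ln k / 2000))"

text \<open>The first exponent is of order (log k)^2 k^(-eps); in the second summand k log k
  outgrows k.\<close>

lemma failure_bound_tendsto_0:
  assumes "\<epsilon> > 0"
  shows "(\<lambda>k. failure_bound \<epsilon> (real k)) \<longlonglongrightarrow> 0"
proof -
  have "(\<lambda>k. 2 * real k * ((2 * ln (real k))\<^sup>2 * exp 1 * real k powr (- 1 - \<epsilon>))) \<longlonglongrightarrow> 0"
    "(\<lambda>k. exp (2 * real k * ln 4) * exp (- (\<epsilon> * real k * ln (real k) / 20))) \<longlonglongrightarrow> 0"
    "(\<lambda>k. 4 * exp (- (\<epsilon> * ln (real k) / 2000))) \<longlonglongrightarrow> 0"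
    using assms by real_asymp+
  from tendsto_add[OF tendsto_add[OF tendsto_diff[OF tendsto_exp[OF this(1)] tendsto_const[of 1]] this(2)] this(3)]
  show ?thesis by (simp add: failure_bound_def)
qed

lemma degree_eq_card_neighbours:
  assumes "finite_simple_graph G"
  shows "degree G v = card {u. {v, u} \<in> edges G}"
proof -
  have "{e \<in> edges G. v \<in> e} = (\<lambda>u. {v, u}) ` {u. {v, u} \<in> edges G}"
  proof (intro set_eqI iffI)
    fix e assume e: "e \<in> {e \<in> edges G. v \<in> e}"
    then have "card e = 2" using assms by (simp add: finite_simple_graph_def)
    then obtain u where "e = {v, u}" using e by (auto simp: card_2_iff)
    then show "e \<in> (\<lambda>u. {v, u}) ` {u. {v, u} \<in> edges G}" using e by auto
  qed auto
  moreover have "inj_on (\<lambda>u. {v, u}) {u. {v, u} \<in> edges G}"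
    by (auto simp: inj_on_def doubleton_eq_iff)
  ultimately show ?thesis by (simp add: degree_def card_image)
qed

lemma prob_nonhamiltonian_le_failure_bound:
  fixes \<epsilon> p :: real and k :: nat
  assumes G: "finite_simple_graph G" and \<epsilon>: "0 < \<epsilon>" "\<epsilon> \<le> 1 / 50"
    and deg: "(1 - \<epsilon>) * k \<le> min_degree G" and card: "card (verts G) \<le> (1 + \<epsilon>) * k"
    and p: "(1 + 4 * \<epsilon>) * ln k / k \<le> p" "p \<le> 1"
    and k: "20 \<le> k" "2 \<le> ln k" "ln k \<le> k / 2" "exp (- (\<epsilon> * ln k / 2000)) \<le> 1 / 4"
  shows "measure_pmf.prob (random_subset (edges G) p) {H. \<not> hamiltonian (Graph (verts G) H)}
    \<le> failure_bound \<epsilon> k"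
proof -
  define V E n where "V = verts G" and "E = edges G" and "n = card V"
  define m where "m = k div 10"
  \<comment> \<open>Order minus minimum degree is at most (1 + eps)k - (1 - eps)k.\<close>
  define r where "r = nat \<lfloor>2 * \<epsilon> * k\<rfloor>"
  define p\<^sub>1 where "p\<^sub>1 = (1 + 7/2 * \<epsilon>) * ln k / k"
  define q where "q = \<epsilon> * ln k / (6 * (real k)\<^sup>2)"
  define \<delta> where "\<delta> = exp (- (\<epsilon> * ln k / 2000))"
  define D where "D = (1 - \<epsilon>) * k"
  have V: "finite V" "V \<noteq> {}" and E: "\<And>e. e \<in> E \<Longrightarrow> e \<subseteq> V"
    using G by (auto simp: finite_simple_graph_def V_def E_def)
  have D: "D \<le> card {u. {v, u} \<in> E}" if "v \<in> V" for v
  proof -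
    have "min_degree G \<le> degree G v"
      using that V unfolding min_degree_def V_def by (intro Min_le) auto
    then show ?thesis
      using deg degree_eq_card_neighbours[OF G] by (simp add: D_def E_def)
  qed
  have sub: "{u. {v, u} \<in> E} \<subseteq> V" for v using E by blast
  have n_le: "n \<le> (1 + \<epsilon>) * k" using card by (simp add: n_def V_def)
  have n_ge: "D \<le> n"
  proof -
    obtain v where "v \<in> V" using V by blast
    then have "D \<le> card {u. {v, u} \<in> E}" by (rule D)
    also have "\<dots> \<le> n" unfolding n_def using sub V by (simp add: card_mono)
    finally show ?thesis .
  qed
  have kpos: "real k > 0" "real k \<ge> 20" using k by auto
  have \<epsilon>k: "\<epsilon> * k \<le> k / 50" "0 < \<epsilon> * k" using \<epsilon> kpos by auto
  have lnpos: "ln k > 0" using k by simp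
  have r: "card (V - {u. {v, u} \<in> E}) \<le> r" if "v \<in> V" for v
  proof -
    have "card (V - {u. {v, u} \<in> E}) = n - card {u. {v, u} \<in> E}"
      unfolding n_def using V sub by (intro card_Diff_subset) (rule finite_subset[OF sub], auto)
    moreover have "card {u. {v, u} \<in> E} \<le> n" unfolding n_def using sub V by (simp add: card_mono)
    ultimately have "real (card (V - {u. {v, u} \<in> E})) \<le> 2 * \<epsilon> * k"
      using D[OF that] n_le by (simp add: D_def algebra_simps)
    then show ?thesis unfolding r_def by linarith
  qed
  have m: "2 \<le> m" "real k / 10 \<le> m + 1" "real m \<le> k / 10" using k(1) unfolding m_def by linarith+
  have r_le: "real r \<le> k / 25" using \<epsilon>k unfolding r_def by linarith
  \<comment> \<open>There are at least k/10 ends, each with at least k/10 - k/25 = 3k/50 usable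
    partners; halving the product gives the constant 3/1000.\<close>
  have boosters: "3 / 1000 * (real k)\<^sup>2 \<le> b" if b: "(m + 1) * (m + 1 - r) \<le> 2 * b" for b :: nat
  proof -
    have "real k / 10 * (3 / 50 * k) \<le> real (m + 1) * real (m + 1 - r)"
      using m r_le by (intro mult_mono) linarith+
    also have "\<dots> \<le> 2 * b" using b by (metis of_nat_le_iff of_nat_mult of_nat_numeral)
    finally show ?thesis by (simp add: power2_eq_square)
  qed
  \<comment> \<open>The 6 in \<open>q\<close> is tuned to n at most 3k/2, so that all 2n rounds
    together cost at most the reserved half eps of the density.\<close>
  have q: "0 \<le> q" "2 * n * q \<le> \<epsilon> / 2 * ln k / k"
  proof -
    show "0 \<le> q" using \<epsilon> lnpos by (simp add: q_def)
    then have "2 * n * q \<le> 2 * (3 / 2 * k) * q"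
      using n_le \<epsilon>k by (intro mult_right_mono) (auto simp: algebra_simps)
    also have "\<dots> = \<epsilon> / 2 * ln k / k" using kpos by (simp add: q_def power2_eq_square)
    finally show "2 * n * q \<le> \<epsilon> / 2 * ln k / k" .
  qed
  have p1: "0 \<le> p\<^sub>1" "p\<^sub>1 + 2 * n * q \<le> p"
  proof -
    show "0 \<le> p\<^sub>1" using \<epsilon> lnpos by (simp add: p\<^sub>1_def)
    have "p\<^sub>1 + \<epsilon> / 2 * ln k / k = (1 + 4 * \<epsilon>) * ln k / k"
      by (simp add: p\<^sub>1_def add_divide_distrib algebra_simps)
    then show "p\<^sub>1 + 2 * n * q \<le> p" using q p by linarith
  qed
  have p1': "p\<^sub>1 \<le> 1" using p1 q p by (smt (verit) mult_nonneg_nonneg of_nat_0_le_iff)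
  have "n > 0" using V by (simp add: n_def card_gt_0_iff)
  then have q1: "q \<le> 1"
  proof -
    have "1 * q \<le> 2 * n * q" using q(1) \<open>n > 0\<close> by (intro mult_right_mono) auto
    then show ?thesis using p1 p by linarith
  qed
  have "measure_pmf.prob (random_subset E p) {H. \<not> hamiltonian (Graph V H)} \<le>
    measure_pmf.prob (random_subset E p\<^sub>1) {H. \<not> expander V H m} + 4 * \<delta>"
  proof (rule prob_nonhamiltonian[OF V E r m(1) p1(1) q(1) q1])
    show "p\<^sub>1 + 2 * card V * q \<le> p" using p1 by (simp add: n_def)
    show "(1 - q) ^ b \<le> \<delta>" if "(m + 1) * (m + 1 - r) \<le> 2 * b" for b
    proof -
      have "(1 - q) ^ b \<le> exp (- q * b)" using power_le_exp q q1 by blast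
      also have "\<dots> \<le> exp (- (q * (3 / 1000 * (real k)\<^sup>2)))"
        using mult_left_mono[OF boosters[OF that] q(1)] by simp
      also have "q * (3 / 1000 * (real k)\<^sup>2) = \<epsilon> * ln k / 2000"
        using kpos by (simp add: q_def)
      finally show ?thesis by (simp add: \<delta>_def)
    qed
  qed (use p k in \<open>auto simp: \<delta>_def\<close>)
  \<comment> \<open>The threshold \<open>a\<close> is \<open>\<epsilon> * k / 10\<close>. A set
    above it has a cut of at least \<open>a\<close> times k/2 edges, which is the value of
    \<open>W\<close>; the connectivity cuts are at least k^2/40, hence larger.\<close>
  also have "measure_pmf.prob (random_subset E p\<^sub>1) {H. \<not> expander V H m} \<le>
    exp (card V * ((p\<^sub>1 * card V)\<^sup>2 * exp 1 * exp (- p\<^sub>1 * (D - 3 * (\<epsilon> * k / 10))))) - 1 +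
    4 ^ card V * exp (- p\<^sub>1 * (\<epsilon> * (real k)\<^sup>2 / 20))"
  proof (rule prob_not_expander[OF V(1) E D p1(1) p1'])
    have "1 \<le> ln k / k * (k / 2)" using k kpos by simp
    also have "\<dots> \<le> p\<^sub>1 * n"
    proof (rule mult_mono)
      show "ln k / k \<le> p\<^sub>1"
        using \<epsilon> lnpos unfolding p\<^sub>1_def by (intro divide_right_mono) auto
      show "k / 2 \<le> n" using n_ge \<epsilon>k by (simp add: D_def left_diff_distrib)
    qed (use p1 in auto)
    finally show "1 \<le> p\<^sub>1 * card V" by (simp add: n_def)
  next
    fix s :: nat assume s: "\<epsilon> * k / 10 < s" "s \<le> m"
    then have "real s \<le> k / 10" using m by linarith
    then have "k / 2 \<le> D - 3 * real s" using \<epsilon>k by (simp add: D_def algebra_simps)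
    then have "\<epsilon> * k / 10 * (k / 2) \<le> s * (D - 3 * real s)"
      using s \<epsilon>k by (intro mult_mono) auto
    then show "\<epsilon> * (real k)\<^sup>2 / 20 \<le> s * (D - 3 * real s)" by (simp add: power2_eq_square)
  next
    fix s :: nat assume s: "m < s" "2 * s \<le> card V"
    then have 1: "k / 10 \<le> s" using m by linarith
    have "2 * real s \<le> n" using s(2) unfolding n_def by linarith
    then have "k / 4 \<le> D - s" using n_le \<epsilon>k by (simp add: D_def algebra_simps)
    then have "k / 10 * (k / 4) \<le> s * (D - s)"
      using 1 by (intro mult_mono) auto
    moreover have "\<epsilon> * (real k)\<^sup>2 / 20 \<le> k / 10 * (k / 4)"
      using mult_right_mono[of \<epsilon> "1 / 2" "(real k)\<^sup>2"] \<epsilon>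
      by (simp add: power2_eq_square)
    ultimately show "\<epsilon> * (real k)\<^sup>2 / 20 \<le> s * (D - s)" by simp
  qed
  also have "card V * ((p\<^sub>1 * card V)\<^sup>2 * exp 1 * exp (- p\<^sub>1 * (D - 3 * (\<epsilon> * k / 10))))
    \<le> 2 * k * ((2 * ln k)\<^sup>2 * exp 1 * k powr (- 1 - \<epsilon>))"
  proof -
    have 1: "card V \<le> 2 * real k" using n_le \<epsilon>k by (simp add: n_def algebra_simps)
    have "p\<^sub>1 * n \<le> (8 / 5 * ln k / k) * (5 / 4 * k)"
    proof (rule mult_mono)
      show "p\<^sub>1 \<le> 8 / 5 * ln k / k"
        using \<epsilon> lnpos unfolding p\<^sub>1_def by (intro divide_right_mono mult_right_mono) auto
      show "n \<le> 5 / 4 * real k" using n_le[unfolded distrib_right] \<epsilon>k by linarith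
    qed (use lnpos in auto)
    also have "\<dots> = 2 * ln k" using kpos by simp
    finally have 2: "p\<^sub>1 * card V \<le> 2 * ln k" by (simp add: n_def)
    \<comment> \<open>Minimum degree and threshold cost 13/10 eps against the gain of 7/2 eps in
      \<open>p\<^sub>1\<close>. The remaining exponent (1 + eps) log k yields k^(-1-eps) per vertex,
      small enough to absorb the sum over about k vertices and the squared logarithm.\<close>
    have 3: "(1 + \<epsilon>) * ln k \<le> p\<^sub>1 * (D - 3 * (\<epsilon> * k / 10))"
    proof -
      have "p\<^sub>1 * (D - 3 * (\<epsilon> * k / 10)) = ((1 + 7/2 * \<epsilon>) * (1 - 13/10 * \<epsilon>)) * ln k"
        using kpos by (simp add: p\<^sub>1_def D_def field_simps)
      moreover have "1 + \<epsilon> \<le> (1 + 7/2 * \<epsilon>) * (1 - 13/10 * \<epsilon>)"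
      proof -
        have "\<epsilon> * \<epsilon> \<le> \<epsilon> * (1 / 50)" using \<epsilon> by (intro mult_left_mono) auto
        then show ?thesis using \<epsilon>(1) by (simp add: algebra_simps)
      qed
      ultimately show ?thesis using lnpos by (simp add: mult_right_mono)
    qed
    have "k powr (- 1 - \<epsilon>) = exp (- ((1 + \<epsilon>) * ln k))"
      using kpos by (simp add: powr_def algebra_simps)
    then have "exp (- p\<^sub>1 * (D - 3 * (\<epsilon> * k / 10))) \<le> k powr (- 1 - \<epsilon>)"
      using 3 by simp
    moreover have "(p\<^sub>1 * card V)\<^sup>2 \<le> (2 * ln k)\<^sup>2"
      using 2 p1(1) by (intro power_mono) auto
    ultimately show ?thesis
      using 1 by (intro mult_mono) auto
  qed
  also have "4 ^ card V * exp (- p\<^sub>1 * (\<epsilon> * (real k)\<^sup>2 / 20)) \<le>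
    exp (2 * k * ln 4) * exp (- (\<epsilon> * k * ln k / 20))"
  proof (rule mult_mono)
    have "(4::real) ^ card V = exp (card V * ln 4)" by (simp add: exp_of_nat_mult)
    also have "\<dots> \<le> exp (2 * k * ln 4)" using n_le \<epsilon>k by (simp add: n_def algebra_simps)
    finally show "(4::real) ^ card V \<le> exp (2 * k * ln 4)" .
    have "ln k / k * (\<epsilon> * (real k)\<^sup>2 / 20) \<le> p\<^sub>1 * (\<epsilon> * (real k)\<^sup>2 / 20)"
      using \<epsilon> lnpos kpos unfolding p\<^sub>1_def
      by (intro mult_right_mono divide_right_mono) auto
    then show "exp (- p\<^sub>1 * (\<epsilon> * (real k)\<^sup>2 / 20)) \<le> exp (- (\<epsilon> * k * ln k / 20))"
      using kpos by (simp add: power2_eq_square mult_ac)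
  qed auto
  finally show ?thesis by (simp add: failure_bound_def V_def E_def \<delta>_def)
qed

text \<open>For large k the probability is squeezed between
  \<open>1 - failure_bound \<epsilon> k\<close> and 1. The witness 1/50 keeps the number of
  non-neighbours at most k/25, well below the k/10 rotation ends.\<close>

theorem theorem3p2:
  "\<exists>\<epsilon>\<^sub>0::real. \<epsilon>\<^sub>0 > 0 \<and>
     (\<forall>\<epsilon>::real. 0 < \<epsilon> \<and> \<epsilon> \<le> \<epsilon>\<^sub>0 \<longrightarrow>
       (\<forall>(G :: nat \<Rightarrow> 'a graph) (p :: nat \<Rightarrow> real).
          (\<forall>k. finite_simple_graph (G k)) \<and>
          (\<forall>k. 0 \<le> p k \<and> p k \<le> 1) \<and>
          (\<forall>\<^sub>F k in sequentially. real (min_degree (G k)) \<ge> (1 - \<epsilon>) * real k) \<and>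
          (\<forall>\<^sub>F k in sequentially. real (card (verts (G k))) \<le> (1 + \<epsilon>) * real k) \<and>
          (\<forall>\<^sub>F k in sequentially. p k \<ge> (1 + 4 * \<epsilon>) * ln (real k) / real k) \<longrightarrow>
          ((\<lambda>k. measure_pmf.prob (random_subgraph (G k) (p k)) {H. hamiltonian H})
             \<longlonglongrightarrow> 1)))"
proof (intro exI[of _ "1 / 50"] conjI allI impI; (elim conjE)?)
  fix \<epsilon> :: real and G :: "nat \<Rightarrow> 'a graph" and p :: "nat \<Rightarrow> real"
  assume \<epsilon>: "0 < \<epsilon>" "\<epsilon> \<le> 1 / 50"
    and G: "\<forall>k. finite_simple_graph (G k)" and p: "\<forall>k. 0 \<le> p k \<and> p k \<le> 1"
    and ev: "\<forall>\<^sub>F k in sequentially. (1 - \<epsilon>) * real k \<le> real (min_degree (G k))"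
      "\<forall>\<^sub>F k in sequentially. real (card (verts (G k))) \<le> (1 + \<epsilon>) * real k"
      "\<forall>\<^sub>F k in sequentially. (1 + 4 * \<epsilon>) * ln (real k) / real k \<le> p k"
  let ?P = "\<lambda>k. measure_pmf.prob (random_subgraph (G k) (p k)) {H. hamiltonian H}"
  have large: "\<forall>\<^sub>F k in sequentially. 2 \<le> ln (real k)" "\<forall>\<^sub>F k in sequentially. ln (real k) \<le> real k / 2"
    "\<forall>\<^sub>F k in sequentially. exp (- (\<epsilon> * ln (real k) / 2000)) \<le> 1 / 4"
    using \<epsilon>(1) by real_asymp+
  have "\<forall>\<^sub>F k in sequentially. 1 - failure_bound \<epsilon> (real k) \<le> ?P k"
    using ev large eventually_ge_at_top[of 20]
  proof eventually_elim
    case (elim k)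
    have "measure_pmf.prob (random_subset (edges (G k)) (p k)) {H. \<not> hamiltonian (Graph (verts (G k)) H)}
      \<le> failure_bound \<epsilon> k"
      by (rule prob_nonhamiltonian_le_failure_bound) (use elim \<epsilon> G p in auto)
    moreover have "?P k = 1 - measure_pmf.prob (random_subset (edges (G k)) (p k))
        {H. \<not> hamiltonian (Graph (verts (G k)) H)}"
      using measure_pmf.prob_compl[of "{H. \<not> hamiltonian (Graph (verts (G k)) H)}"
          "random_subset (edges (G k)) (p k)"]
      by (simp add: random_subgraph_eq vimage_def Compl_eq_Diff_UNIV[symmetric] Collect_neg_eq[symmetric])
    ultimately show ?case by linarith
  qed
  moreover have "(\<lambda>k. 1 - failure_bound \<epsilon> (real k)) \<longlonglongrightarrow> 1"
    using tendsto_diff[OF tendsto_const[of "1::real"] failure_bound_tendsto_0[OF \<epsilon>(1)]] by simp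
  ultimately show "?P \<longlonglongrightarrow> 1"
    by (intro real_tendsto_sandwich[where g = ?P and h = "\<lambda>_. 1"]) simp_all
qed simp

end
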